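(* Let $D$ be an oriented diagram of a knot that is either a positive diagram (it has no negative crossings) or a negative diagram (it has no positive crossings). Then the bound $s(D)\le U(D)$ is tight for $D$, i.e. $$s(D)=U(D).$$
   Context: Rasmussen invariant: for a diagram $D$ of a knot $K$, consider Lee's filtered chain complex $\mathscr{F}^jC^i(D)$ with complex coefficients, i.e. the perturbed Khovanov complex built from the Frobenius algebra $\mathbb{C}\hookrightarrow \mathbb{C}[x]/(x^2-1)$, where $i$ is the homological grading and $\cdots\subseteq\mathscr{F}^{j+1}C^i\subseteq\mathscr{F}^jC^i\subseteq\cdots$ is the quantum filtration. Its homology is 2-dimensional, supported in $i=0$, and generated by Lee's canonical classes $[\mathfrak{s}_o],[\mathfrak{s}_{\bar o}]$ associated with the orientation $o$ of $D$ and the reverse orientation. Let $s_{\min}(D)$ be the largest $j$ such that $[\mathfrak{s}_o]$ (equivalently $[\mathfrak{s}_{\bar o}]$) lies in $\mathscr{F}^jH^0(D)$. Then $s(D)=s(K)=s_{\min}(D)+1\in 2\mathbb{Z}$. This depends only on $K$, and with this normalization $s(K)=2g^*(K)$ for positive knots, where $g^*$ is the smooth slice genus. Seifert graph: let $O(D)$ be the oriented resolution of $D$ (every crossing is smoothed respecting orientation), a disjoint union of circles. The Seifert graph $T(D)$ has one node for each circle of $O(D)$ and, for each positive (respectively negative) crossing of $D$, one edge decorated with $+$ (respectively $-$) joining the two distinct circles on which the smoothed crossing lies. The subgraph $T^-(D)$ (respectively $T^+(D)$) is obtained from $T(D)$ by removing all edges decorated with $+$ (respectively $-$), keeping all nodes.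 Let $w(D)$ be the writhe of $D$ (number of positive crossings minus number of negative crossings). Define $$U(D)=\#\mathrm{nodes}(T(D))-2\,\#\mathrm{components}(T^-(D))+w(D)+1 .$$ *)

theory Defs
  imports Complex_Main "HOL-Library.FuncSet"
begin

section \<open>Oriented knot diagrams\<close>

text \<open>
  A knot diagram with \<open>n\<close> crossings is given by its signed Gauss code.  Travelling along the knot
  in the direction of its orientation, one meets the edges \<open>0, 1, \<dots>, 2n - 1\<close> in cyclic order, and
  the \<open>e\<close>-th passage through a crossing leads from the edge \<open>e\<close> to the edge \<open>e + 1 (mod 2n)\<close>.
  A crossing records the passage along its lower strand, the passage along its upper strand, and
  its sign.  The diagram without crossings is a circle, with the single edge \<open>0\<close>.

  The component \<open>outer\<close> names a side of an edge that faces the unbounded region of the plane.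
\<close>

datatype side = Left | Right

datatype direction = Incoming | Outgoing

record crossing =
  under :: nat
  over :: nat
  positive :: bool

record diagram =
  crossings :: "crossing list"
  outer :: "nat \<times> side"

definition num_crossings :: "diagram \<Rightarrow> nat" where
  "num_crossings D = length (crossings D)"

definition num_edges :: "diagram \<Rightarrow> nat" where
  "num_edges D = max 1 (2 * num_crossings D)"

definition edges :: "diagram \<Rightarrow> nat set" where
  "edges D = {..<num_edges D}"

definition next_edge :: "diagram \<Rightarrow> nat \<Rightarrow> nat" where
  "next_edge D e = Suc e mod num_edges D"

text \<open>
  The four ends of edges at a crossing, listed counterclockwise from the incoming lower one
  (so that the edges form the usual planar diagram code \<open>X[i,j,k,l]\<close>).
\<close>

definition edge_ends :: "diagram \<Rightarrow> crossing \<Rightarrow> (nat \<times> direction) list" where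
  "edge_ends D c =
    (if positive c
     then [(under c, Incoming), (next_edge D (over c), Outgoing),
           (next_edge D (under c), Outgoing), (over c, Incoming)]
     else [(under c, Incoming), (over c, Incoming),
           (next_edge D (under c), Outgoing), (next_edge D (over c), Outgoing)])"

definition edge_at :: "diagram \<Rightarrow> crossing \<Rightarrow> nat \<Rightarrow> nat" where
  "edge_at D c t = fst (edge_ends D c ! t)"

text \<open>
  Seen from a crossing, the side of an edge which is reached by turning counterclockwise
  (respectively clockwise) from the end of the edge.
\<close>

fun ccw_side :: "nat \<times> direction \<Rightarrow> nat \<times> side" where
  "ccw_side (e, Incoming) = (e, Right)"
| "ccw_side (e, Outgoing) = (e, Left)"

fun cw_side :: "nat \<times> direction \<Rightarrow> nat \<times> side" where
  "cw_side (e, Incoming) = (e, Left)"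
| "cw_side (e, Outgoing) = (e, Right)"

definition corners :: "diagram \<Rightarrow> ((nat \<times> side) \<times> (nat \<times> side)) set" where
  "corners D = {(ccw_side (edge_ends D c ! t), cw_side (edge_ends D c ! (Suc t mod 4))) | c t.
     c \<in> set (crossings D) \<and> t < 4}"

text \<open>The classes of \<open>A\<close> modulo the equivalence relation generated by \<open>r \<subseteq> A \<times> A\<close>.\<close>

definition classes :: "'a set \<Rightarrow> ('a \<times> 'a) set \<Rightarrow> 'a set set" where
  "classes A r = A // (r \<union> r\<inverse>)\<^sup>*"

definition regions :: "diagram \<Rightarrow> (nat \<times> side) set set" where
  "regions D = classes (edges D \<times> UNIV) (corners D)"

text \<open>
  Every one of the \<open>2n\<close> passages occurs exactly once, and the diagram is planar: its underlying
  connected graph, with \<open>n\<close> vertices and \<open>2n\<close> edges, has Euler characteristic \<open>2\<close>, that is,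
  \<open>n - 2n + #regions = 2\<close>.
\<close>

definition knot_diagram :: "diagram \<Rightarrow> bool" where
  "knot_diagram D \<longleftrightarrow>
     distinct (map under (crossings D) @ map over (crossings D)) \<and>
     set (map under (crossings D) @ map over (crossings D)) = {..<2 * num_crossings D} \<and>
     card (regions D) = num_crossings D + 2 \<and>
     fst (outer D) \<in> edges D"

definition positive_diagram :: "diagram \<Rightarrow> bool" where
  "positive_diagram D \<longleftrightarrow> (\<forall>c \<in> set (crossings D). positive c)"

definition negative_diagram :: "diagram \<Rightarrow> bool" where
  "negative_diagram D \<longleftrightarrow> (\<forall>c \<in> set (crossings D). \<not> positive c)"

definition pos_crossings :: "diagram \<Rightarrow> nat set" where
  "pos_crossings D = {k. k < num_crossings D \<and> positive (crossings D ! k)}"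

definition neg_crossings :: "diagram \<Rightarrow> nat set" where
  "neg_crossings D = {k. k < num_crossings D \<and> \<not> positive (crossings D ! k)}"

definition writhe :: "diagram \<Rightarrow> int" where
  "writhe D = int (card (pos_crossings D)) - int (card (neg_crossings D))"


section \<open>Resolutions\<close>

text \<open>
  The \<open>0\<close>-smoothing (\<open>False\<close>) joins the two regions swept out by the upper strand when it is
  turned counterclockwise.
\<close>

definition smoothing :: "diagram \<Rightarrow> crossing \<Rightarrow> bool \<Rightarrow> (nat \<times> nat) set" where
  "smoothing D c b =
    (if b then {(edge_at D c 0, edge_at D c 3), (edge_at D c 1, edge_at D c 2)}
     else {(edge_at D c 0, edge_at D c 1), (edge_at D c 2, edge_at D c 3)})"

text \<open>
  A vertex of the cube of resolutions is the set \<open>v\<close> of crossings that are \<open>1\<close>-smoothed; a circle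
  is represented by the set of edges it runs through.
\<close>

definition circles :: "diagram \<Rightarrow> nat set \<Rightarrow> nat set set" where
  "circles D v =
     classes (edges D) (\<Union>k < num_crossings D. smoothing D (crossings D ! k) (k \<in> v))"

text \<open>
  The smoothing that respects the orientation is the \<open>0\<close>-smoothing at a positive crossing and the
  \<open>1\<close>-smoothing at a negative one.
\<close>

abbreviation oriented_circles :: "diagram \<Rightarrow> nat set set" where
  "oriented_circles D \<equiv> circles D (neg_crossings D)"


section \<open>The Seifert graph\<close>

record ('v, 'e) signed_graph =
  nodes :: "'v set"
  graph_edges :: "'e set"
  endpoints :: "'e \<Rightarrow> 'v set"
  plus :: "'e \<Rightarrow> bool"

definition adjacency :: "('v, 'e) signed_graph \<Rightarrow> ('v \<times> 'v) set" where
  "adjacency G = {(a, b). \<exists>e \<in> graph_edges G. endpoints G e = {a, b}}"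

definition components :: "('v, 'e) signed_graph \<Rightarrow> 'v set set" where
  "components G = classes (nodes G) (adjacency G)"

definition minus_subgraph :: "('v, 'e) signed_graph \<Rightarrow> ('v, 'e) signed_graph" where
  "minus_subgraph G = G\<lparr>graph_edges := {e \<in> graph_edges G. \<not> plus G e}\<rparr>"

text \<open>
  The two arcs of the oriented smoothing of a crossing continue the two edges coming into it.
\<close>

definition seifert_graph :: "diagram \<Rightarrow> (nat set, nat) signed_graph" where
  "seifert_graph D =
    \<lparr>nodes = oriented_circles D,
     graph_edges = {..<num_crossings D},
     endpoints = (\<lambda>k. {c \<in> oriented_circles D.
                        under (crossings D ! k) \<in> c \<or> over (crossings D ! k) \<in> c}),
     plus = (\<lambda>k. positive (crossings D ! k))\<rparr>"

definition U_bound :: "diagram \<Rightarrow> int" where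
  "U_bound D = int (card (nodes (seifert_graph D)))
     - 2 * int (card (components (minus_subgraph (seifert_graph D)))) + writhe D + 1"


section \<open>Lee's filtered complex\<close>

text \<open>
  The basis \<open>1, x\<close> of the Frobenius algebra \<open>\<complex>[x]/(x\<^sup>2 - 1)\<close>.  Products of basis elements are basis
  elements, and the comultiplication \<open>1 \<mapsto> 1 \<otimes> x + x \<otimes> 1\<close>, \<open>x \<mapsto> x \<otimes> x + 1 \<otimes> 1\<close> takes a basis
  element to the sum of a set of pure tensors of basis elements.
\<close>

datatype lee_basis = One | X

fun lee_mult :: "lee_basis \<Rightarrow> lee_basis \<Rightarrow> lee_basis" where
  "lee_mult One b = b"
| "lee_mult X One = X"
| "lee_mult X X = One"

fun lee_comult :: "lee_basis \<Rightarrow> (lee_basis \<times> lee_basis) set" where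
  "lee_comult One = {(One, X), (X, One)}"
| "lee_comult X = {(X, X), (One, One)}"

fun lee_degree :: "lee_basis \<Rightarrow> int" where
  "lee_degree One = 1"
| "lee_degree X = -1"

text \<open>
  The tensor power of the algebra over the circles of a resolution has as its basis the labellings
  of the circles by \<open>1\<close> and \<open>x\<close>.  Chains are coefficient functions on the pairs of a resolution
  and a labelling of its circles.
\<close>

definition labellings :: "diagram \<Rightarrow> nat set \<Rightarrow> (nat set \<Rightarrow> lee_basis) set" where
  "labellings D v = (circles D v \<rightarrow>\<^sub>E UNIV)"

type_synonym generator = "nat set \<times> (nat set \<Rightarrow> lee_basis)"

type_synonym chain = "generator \<Rightarrow> complex"

definition generators :: "diagram \<Rightarrow> generator set" where
  "generators D = Sigma (Pow {..<num_crossings D}) (labellings D)"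

definition hom_degree :: "diagram \<Rightarrow> generator \<Rightarrow> int" where
  "hom_degree D = (\<lambda>(v, f). int (card v) - int (card (neg_crossings D)))"

definition q_degree :: "diagram \<Rightarrow> generator \<Rightarrow> int" where
  "q_degree D = (\<lambda>(v, f). (\<Sum>c \<in> circles D v. lee_degree (f c)) + int (card v)
     + int (card (pos_crossings D)) - 2 * int (card (neg_crossings D)))"

definition lee_chains :: "diagram \<Rightarrow> int \<Rightarrow> chain set" where
  "lee_chains D i = {z. \<forall>g. z g \<noteq> 0 \<longrightarrow> g \<in> generators D \<and> hom_degree D g = i}"

definition lee_filtration :: "diagram \<Rightarrow> int \<Rightarrow> int \<Rightarrow> chain set" where
  "lee_filtration D j i = {z \<in> lee_chains D i. \<forall>g. z g \<noteq> 0 \<longrightarrow> j \<le> q_degree D g}"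

text \<open>
  The labelling \<open>f'\<close> of the circles \<open>B\<close> occurs (with coefficient \<open>1\<close>) in the image of the labelling
  \<open>f\<close> of the circles \<open>A\<close> under the map induced by merging two circles or splitting one.
\<close>

definition lee_edge ::
  "nat set set \<Rightarrow> (nat set \<Rightarrow> lee_basis) \<Rightarrow> nat set set \<Rightarrow> (nat set \<Rightarrow> lee_basis) \<Rightarrow> bool" where
  "lee_edge A f B f' \<longleftrightarrow>
     (\<forall>c \<in> A \<inter> B. f' c = f c) \<and>
     ((\<exists>a b c. a \<noteq> b \<and> A - B = {a, b} \<and> B - A = {c} \<and> f' c = lee_mult (f a) (f b)) \<or>
      (\<exists>a b c. a \<noteq> b \<and> A - B = {c} \<and> B - A = {a, b} \<and> (f' a, f' b) \<in> lee_comult (f c)))"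

text \<open>
  The coefficient of the differential at \<open>(v, f)\<close> collects the contributions of the edges of the
  cube that end at \<open>v\<close>, with the usual signs.
\<close>

definition lee_differential :: "diagram \<Rightarrow> chain \<Rightarrow> chain" where
  "lee_differential D z = (\<lambda>(v, f).
     if (v, f) \<in> generators D then
       \<Sum>k \<in> v. (-1) ^ card {l \<in> v. l < k} *
         (\<Sum>g \<in> {g \<in> labellings D (v - {k}). lee_edge (circles D (v - {k})) g (circles D v) f}.
            z (v - {k}, g))
     else 0)"

definition lee_cycles :: "diagram \<Rightarrow> int \<Rightarrow> chain set" where
  "lee_cycles D i = {z \<in> lee_chains D i. lee_differential D z = (\<lambda>_. 0)}"

definition lee_boundaries :: "diagram \<Rightarrow> int \<Rightarrow> chain set" where
  "lee_boundaries D i = lee_differential D ` lee_chains D (i - 1)"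

definition homology_class :: "diagram \<Rightarrow> int \<Rightarrow> chain \<Rightarrow> chain set" where
  "homology_class D i z = {(\<lambda>g. z g + b g) | b. b \<in> lee_boundaries D i}"

text \<open>
  The filtration on homology: the image of the homology of the \<open>j\<close>-th step of the complex.
\<close>

definition homology_filtration :: "diagram \<Rightarrow> int \<Rightarrow> int \<Rightarrow> chain set set" where
  "homology_filtration D j i = homology_class D i ` (lee_cycles D i \<inter> lee_filtration D j i)"


section \<open>The canonical generator and the Rasmussen invariant\<close>

text \<open>
  \<open>(s, p)\<close> belongs to this relation if some path in the plane, avoiding the crossings, leads from
  the unbounded region to the side \<open>s\<close> and crosses the diagram (equivalently, the circles of any
  of its resolutions) an even (\<open>p = False\<close>) or odd (\<open>p = True\<close>) number of times.
\<close>

inductive_set crossing_parity :: "diagram \<Rightarrow> ((nat \<times> side) \<times> bool) set" for D :: diagram where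
  start: "(outer D, False) \<in> crossing_parity D"
| turn: "(s, p) \<in> crossing_parity D \<Longrightarrow> (s, t) \<in> corners D \<union> (corners D)\<inverse>
    \<Longrightarrow> (t, p) \<in> crossing_parity D"
| cross_left: "((e, Left), p) \<in> crossing_parity D \<Longrightarrow> ((e, Right), \<not> p) \<in> crossing_parity D"
| cross_right: "((e, Right), p) \<in> crossing_parity D \<Longrightarrow> ((e, Left), \<not> p) \<in> crossing_parity D"

text \<open>
  Lee's rule labels a circle \<open>c\<close> of the oriented resolution by \<open>a = x + 1\<close> or \<open>b = x - 1\<close>,
  according to the parity of the number of other circles separating \<open>c\<close> from infinity, plus one if
  \<open>c\<close> runs counterclockwise.  As \<open>c\<close> runs counterclockwise iff its left side is its inside, this is
  the parity of the number of circles, \<open>c\<close> included, met on the way from infinity to the left side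
  of \<open>c\<close>.
\<close>

definition odd_circle :: "diagram \<Rightarrow> nat set \<Rightarrow> bool" where
  "odd_circle D c \<longleftrightarrow> (\<exists>e \<in> c. ((e, Left), True) \<in> crossing_parity D)"

fun canonical_coeff :: "bool \<Rightarrow> lee_basis \<Rightarrow> complex" where
  "canonical_coeff b X = 1"
| "canonical_coeff b One = (if b then -1 else 1)"

definition canonical_chain :: "diagram \<Rightarrow> chain" where
  "canonical_chain D = (\<lambda>(v, f).
     if v = neg_crossings D \<and> f \<in> labellings D v
     then \<Prod>c \<in> circles D v. canonical_coeff (odd_circle D c) (f c)
     else 0)"

definition s_min :: "diagram \<Rightarrow> int" where
  "s_min D = (GREATEST j. homology_class D 0 (canonical_chain D) \<in> homology_filtration D j 0)"

definition rasmussen_s :: "diagram \<Rightarrow> int" where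
  "rasmussen_s D = s_min D + 1"

end

theory Submission
  imports Defs
begin

text \<open>
  The checkerboard colouring of the regions of a planar diagram labels the two Seifert circles that
  meet at a crossing differently.  They are therefore distinct, and the other smoothing of that
  crossing merges them.

  In a positive diagram the oriented resolution is the initial vertex of the cube.  There are no
  boundaries in degree \<open>0\<close>, so the filtration level of the canonical class is that of its lowest
  term, the one with every circle labelled \<open>x\<close>.

  In a negative diagram the oriented resolution is the final vertex.  The homology in degree \<open>0\<close> is
  the quotient of \<open>\<complex>[x\<^sub>c]/(x\<^sub>c\<^sup>2 - 1)\<close>, with one variable for each circle \<open>c\<close>, by the relations
  \<open>x\<^sub>a + x\<^sub>b = 0\<close> for adjacent circles \<open>a\<close>, \<open>b\<close>.  Since the Seifert graph is connected, every class
  is represented by a chain in which at most one circle is labelled \<open>x\<close>; and \<open>x\<close> cannot be avoided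
  altogether, because the two evaluations \<open>x\<^sub>c \<mapsto> \<plusminus>\<epsilon>\<^sub>c\<close> take different values at the canonical class.
\<close>

section \<open>Checkerboard colouring and Seifert circles\<close>

lemma classes_eq: "classes A r = (\<lambda>x. (r \<union> r\<inverse>)\<^sup>* `` {x}) ` A"
  by (auto simp: classes_def quotient_def)

lemma sym_closure_class_eq_iff:
  "(r \<union> r\<inverse>)\<^sup>* `` {x} = (r \<union> r\<inverse>)\<^sup>* `` {y} \<longleftrightarrow> (x, y) \<in> (r \<union> r\<inverse>)\<^sup>*"
proof -
  have "equiv UNIV ((r \<union> r\<inverse>)\<^sup>*)"
    by (auto simp: equiv_def refl_on_def trans_rtrancl intro!: sym_rtrancl sym_Un_converse)
  then show ?thesis
    by (simp add: eq_equiv_class_iff)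
qed

section \<open>Edges and strands of a knot diagram\<close>

locale diagram_of_knot =
  fixes D :: diagram
  assumes knot: "knot_diagram D"
begin

abbreviation "n \<equiv> num_crossings D"
abbreviation "nx \<equiv> next_edge D"
abbreviation "neg \<equiv> neg_crossings D"

text \<open>
  Turning counterclockwise at the \<open>k\<close>-th crossing from the incoming end \<open>p k\<close>, one meets the outgoing
  end that follows \<open>q k\<close> first.  In these terms the two kinds of crossings look the same.
\<close>

definition p :: "nat \<Rightarrow> nat" where
  "p k = (if positive (crossings D ! k) then under (crossings D ! k) else over (crossings D ! k))"

definition q :: "nat \<Rightarrow> nat" where
  "q k = (if positive (crossings D ! k) then over (crossings D ! k) else under (crossings D ! k))"

lemma neg_iff: "k < n \<Longrightarrow> k \<in> neg \<longleftrightarrow> \<not> positive (crossings D ! k)"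
  by (simp add: neg_crossings_def)

lemma neg_subset: "neg \<subseteq> {..<n}"
  by (auto simp: neg_crossings_def)

lemma finite_edges [simp]: "finite (edges D)"
  by (simp add: edges_def)

lemma edges_pos: "n > 0 \<Longrightarrow> edges D = {..<2 * n}"
  by (auto simp: edges_def num_edges_def)

lemma zero_edge [simp]: "0 \<in> edges D"
  by (simp add: edges_def num_edges_def)

lemma next_edge_edge [simp]: "nx e \<in> edges D"
  by (simp add: edges_def next_edge_def num_edges_def)

lemma passages:
  "(\<Union>k<n. {under (crossings D ! k), over (crossings D ! k)}) = {..<2 * n}"
proof -
  have "{..<2 * n} = set (map under (crossings D) @ map over (crossings D))"
    using knot by (simp add: knot_diagram_def)
  also have "\<dots> = (\<Union>c \<in> set (crossings D). {under c, over c})"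
    by auto
  also have "\<dots> = (\<Union>k<n. {under (crossings D ! k), over (crossings D ! k)})"
    unfolding num_crossings_def set_conv_nth by blast
  finally show ?thesis by simp
qed

lemma passages_inj:
  assumes "k < n" "l < n"
  shows "under (crossings D ! k) = under (crossings D ! l) \<longleftrightarrow> k = l"
    and "over (crossings D ! k) = over (crossings D ! l) \<longleftrightarrow> k = l"
    and "under (crossings D ! k) \<noteq> over (crossings D ! l)"
proof -
  let ?xs = "map under (crossings D) @ map over (crossings D)"
  have d: "distinct ?xs"
    using knot by (simp add: knot_diagram_def)
  have n: "n = length (crossings D)"
    by (simp add: num_crossings_def)
  have "?xs ! k = ?xs ! l \<longleftrightarrow> k = l"
    by (rule nth_eq_iff_index_eq[OF d]) (use assms n in auto)
  then show "under (crossings D ! k) = under (crossings D ! l) \<longleftrightarrow> k = l"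
    using assms n by (simp add: nth_append)
  have "?xs ! (n + k) = ?xs ! (n + l) \<longleftrightarrow> n + k = n + l"
    by (rule nth_eq_iff_index_eq[OF d]) (use assms n in auto)
  then show "over (crossings D ! k) = over (crossings D ! l) \<longleftrightarrow> k = l"
    using assms n by (simp add: nth_append)
  have "?xs ! k = ?xs ! (n + l) \<longleftrightarrow> k = n + l"
    by (rule nth_eq_iff_index_eq[OF d]) (use assms n in auto)
  then show "under (crossings D ! k) \<noteq> over (crossings D ! l)"
    using assms n by (simp add: nth_append)
qed

lemma strand_inj:
  assumes "k < n" "l < n"
  shows "p k = p l \<longleftrightarrow> k = l" "q k = q l \<longleftrightarrow> k = l" "p k \<noteq> q l" "q l \<noteq> p k"
  using passages_inj[OF assms] passages_inj[OF assms(2) assms(1)]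
  by (auto simp: p_def q_def)

lemma strand_edge [simp]:
  assumes "k < n"
  shows "p k \<in> edges D" "q k \<in> edges D"
  using passages assms edges_pos by (auto simp: p_def q_def)

lemma edge_cases:
  assumes "e \<in> edges D" "n > 0"
  obtains k where "k < n" "e = p k \<or> e = q k"
proof -
  have "e \<in> (\<Union>k<n. {under (crossings D ! k), over (crossings D ! k)})"
    using assms edges_pos passages by simp
  then obtain k where "k < n" "e = p k \<or> e = q k"
    by (auto simp: p_def q_def split: if_splits)
  then show thesis using that by blast
qed

lemma nx_inj:
  assumes "e \<in> edges D" "e' \<in> edges D" "nx e = nx e'"
  shows "e = e'"
proof -
  have "e < num_edges D" "e' < num_edges D"
    using assms by (auto simp: edges_def)
  with assms(3) show ?thesis
    by (auto simp: next_edge_def mod_Suc split: if_splits)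
qed

text \<open>The edges of a knot diagram form a single cycle under \<open>nx\<close>, so a property
  that passes along both strands of every crossing spreads from one edge to all. Connectedness
  enters the later arguments in this form.\<close>

lemma edge_induct:
  assumes "e0 \<in> edges D" "P e0" "e \<in> edges D"
    and p: "\<And>k. k < n \<Longrightarrow> P (p k) \<Longrightarrow> P (nx (p k))"
    and q: "\<And>k. k < n \<Longrightarrow> P (q k) \<Longrightarrow> P (nx (q k))"
  shows "P e"
proof (cases "n = 0")
  case True
  with assms show ?thesis by (simp add: edges_def num_edges_def)
next
  case False
  have step: "P (nx e)" if "e \<in> edges D" "P e" for e
  proof -
    have "n > 0" using False by simp
    then obtain k where "k < n" "e = p k \<or> e = q k"
      by (rule edge_cases[OF \<open>e \<in> edges D\<close>])
    then show ?thesis using \<open>P e\<close> p q by auto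
  qed
  have le: "P (a + m)" if "P a" "a + m \<in> edges D" for a m
    using that(2)
  proof (induction m)
    case (Suc m)
    then have "P (nx (a + m))"
      by (intro step) (auto simp: edges_def)
    with Suc.prems show ?case by (simp add: next_edge_def edges_def)
  qed (use that in simp)
  have N: "num_edges D > 0" "e0 < num_edges D"
    using assms by (auto simp: num_edges_def edges_def)
  \<comment> \<open>\<open>le\<close> only climbs, so the edges before \<open>e0\<close> are reached
    by going up to the last edge and wrapping around to \<open>0\<close>.\<close>
  have "P (e0 + (num_edges D - 1 - e0))"
    by (rule le) (use assms N in \<open>auto simp: edges_def\<close>)
  then have "P (nx (num_edges D - 1))"
    using N by (intro step) (auto simp: edges_def)
  then have "P 0"
    using N by (simp add: next_edge_def)
  from le[OF this, of e] assms(3) show ?thesis by simp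
qed

section \<open>Corners, regions and their colourings\<close>

lemma corners_sym:
  "corners D \<union> (corners D)\<inverse> =
    (\<Union>k<n. let A = {((p k, Right), (nx (q k), Right)), ((nx (q k), Left), (nx (p k), Right)),
                      ((nx (p k), Left), (q k, Left)), ((q k, Right), (p k, Left))}
             in A \<union> A\<inverse>)"
proof -
  have c: "corners D = (\<Union>k<n. (\<lambda>t. (ccw_side (edge_ends D (crossings D ! k) ! t),
      cw_side (edge_ends D (crossings D ! k) ! (Suc t mod 4)))) ` {0, 1, 2, 3})"
  proof -
    have "t < 4 \<longleftrightarrow> t \<in> {0, 1, 2, 3}" for t :: nat by auto
    then show ?thesis
      unfolding corners_def num_crossings_def set_conv_nth by fastforce
  qed
  \<comment> \<open>Counterclockwise, the ends at either kind of crossing belong to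
    \<open>p k\<close>, \<open>nx (q k)\<close>, \<open>nx (p k)\<close>,
    \<open>q k\<close>.\<close>
  show ?thesis
    unfolding c converse_UNION UN_Un_distrib[symmetric] Let_def
    by (intro SUP_cong refl) (auto simp: edge_ends_def p_def q_def)
qed

lemma corners_edge:
  assumes "(s, t) \<in> corners D \<union> (corners D)\<inverse>"
  shows "fst s \<in> edges D \<and> fst t \<in> edges D"
  using assms unfolding corners_sym by (auto simp: Let_def)

lemma finite_regions: "finite (regions D)"
proof -
  have "card (regions D) \<noteq> 0"
    using knot by (simp add: knot_diagram_def)
  then show ?thesis by (rule card_ge_0_finite[OF neq0_conv[THEN iffD1]])
qed

definition colouring :: "(nat \<times> side \<Rightarrow> bool) \<Rightarrow> bool" where
  "colouring \<chi> \<longleftrightarrow> (\<forall>(s, t) \<in> corners D. \<chi> s = \<chi> t)"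

definition change :: "(nat \<times> side \<Rightarrow> bool) \<Rightarrow> nat \<Rightarrow> bool" where
  "change \<chi> e \<longleftrightarrow> \<chi> (e, Left) \<noteq> \<chi> (e, Right)"

lemma colouring_corner:
  assumes "colouring \<chi>" "(s, t) \<in> corners D \<union> (corners D)\<inverse>"
  shows "\<chi> s = \<chi> t"
  using assms by (auto simp: colouring_def)

lemma colouring_crossing:
  assumes "colouring \<chi>" "k < n"
  shows "\<chi> (nx (q k), Right) = \<chi> (p k, Right)" "\<chi> (nx (p k), Right) = \<chi> (nx (q k), Left)"
    "\<chi> (nx (p k), Left) = \<chi> (q k, Left)" "\<chi> (q k, Right) = \<chi> (p k, Left)"
  by (rule colouring_corner[OF assms(1)], unfold corners_sym, use assms(2) in \<open>force simp: Let_def\<close>)+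

text \<open>Going once around the crossing leads back to the initial colour, so the colour changes
  across an even number of its four ends. Hence one bit per crossing describes both strands.\<close>

lemma change_crossing:
  assumes "colouring \<chi>" "k < n"
  shows "change \<chi> (q k) \<noteq> change \<chi> (nx (q k)) \<longleftrightarrow> change \<chi> (p k) \<noteq> change \<chi> (nx (p k))"
  using colouring_crossing[OF assms] by (auto simp: change_def)

text \<open>The bits on the strands \<open>p k\<close> determine those on the strands
  \<open>q k\<close> by \<open>change_crossing\<close>; then one walks along the knot from the edge
  \<open>0\<close>.\<close>

lemma change_eqI:
  assumes "colouring \<chi>" "colouring \<psi>" "change \<chi> 0 = change \<psi> 0"
    and "\<And>k. k < n \<Longrightarrow> (change \<chi> (p k) = change \<chi> (nx (p k))) =
      (change \<psi> (p k) = change \<psi> (nx (p k)))"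
    and "e \<in> edges D"
  shows "change \<chi> e = change \<psi> e"
proof (rule edge_induct[where P = "\<lambda>e. change \<chi> e = change \<psi> e", OF zero_edge assms(3) assms(5)])
  show "change \<chi> (nx (q k)) = change \<psi> (nx (q k))"
    if "k < n" "change \<chi> (q k) = change \<psi> (q k)" for k
    using that assms(4) change_crossing assms(1,2) by metis
qed (use assms(4) in metis)

text \<open>Equal changes carry agreement across an edge, and corners carry it from edge to edge:
  for example from the left of \<open>p k\<close> to the right of \<open>q k\<close>, across
  \<open>q k\<close>, and on to the left of \<open>nx (p k)\<close>.\<close>

lemma colouring_eqI:
  assumes "colouring \<chi>" "colouring \<psi>" "\<chi> (0, Left) = \<psi> (0, Left)"
    and ch: "\<And>e. e \<in> edges D \<Longrightarrow> change \<chi> e = change \<psi> e"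
    and "e \<in> edges D"
  shows "\<chi> (e, i) = \<psi> (e, i)"
proof -
  have "\<chi> (e, Left) = \<psi> (e, Left)"
  proof (rule edge_induct[where P = "\<lambda>e. \<chi> (e, Left) = \<psi> (e, Left)", OF zero_edge assms(3) assms(5)])
    fix k assume k: "k < n"
    note * = colouring_crossing[OF assms(1) k] colouring_crossing[OF assms(2) k]
    have side: "\<chi> (f, Left) = \<psi> (f, Left) \<longleftrightarrow> \<chi> (f, Right) = \<psi> (f, Right)"
      if "f \<in> edges D" for f
      using ch[OF that] by (auto simp: change_def)
    show "\<chi> (nx (p k), Left) = \<psi> (nx (p k), Left)" if "\<chi> (p k, Left) = \<psi> (p k, Left)"
      using that side[of "q k"] * k by simp
    show "\<chi> (nx (q k), Left) = \<psi> (nx (q k), Left)" if "\<chi> (q k, Left) = \<psi> (q k, Left)"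
      using that side[of "q k"] side[of "p k"] side[of "nx (q k)"] * k by simp
  qed
  with ch[OF assms(5)] show ?thesis
    by (cases i) (auto simp: change_def)
qed

definition region :: "nat \<times> side \<Rightarrow> (nat \<times> side) set" where
  "region s = (corners D \<union> (corners D)\<inverse>)\<^sup>* `` {s}"

lemma regions_eq: "regions D = region ` (edges D \<times> UNIV)"
  by (auto simp: regions_def classes_eq region_def)

lemma colouring_regions: "colouring (\<lambda>s. region s \<in> S)"
proof -
  have "region s = region t" if "(s, t) \<in> corners D" for s t
    unfolding region_def sym_closure_class_eq_iff using that by auto
  then show ?thesis by (auto simp: colouring_def)
qed

text \<open>
  A colouring of the regions is determined by its value at one side, by whether it changes across
  the edge \<open>0\<close>, and by one bit for every crossing.  By Euler's formula there are as many
  colourings as there are such data, so all data occur.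
\<close>

lemma checkerboard_colouring:
  obtains \<chi> where "colouring \<chi>" "\<And>e. e \<in> edges D \<Longrightarrow> change \<chi> e"
proof -
  define col where "col S = (\<lambda>s. region s \<in> S)" for S
  define \<Phi> where "\<Phi> S = (col S (0, Left), change (col S) 0,
    {k. k < n \<and> change (col S) (p k) \<noteq> change (col S) (nx (p k))})" for S
  have col: "colouring (col S)" for S
    unfolding col_def by (rule colouring_regions)
  \<comment> \<open>The coloured sides of edges determine the set of regions, which reduces
    injectivity of \<open>\<Phi>\<close> to \<open>colouring_eqI\<close>.\<close>
  have recover: "S = region ` {s \<in> edges D \<times> UNIV. col S s}" if "S \<subseteq> regions D" for S
    using that by (auto simp: regions_eq col_def)
  let ?B = "(UNIV :: bool set) \<times> (UNIV :: bool set) \<times> Pow {..<n}"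
  have inj: "inj_on \<Phi> (Pow (regions D))"
  proof (rule inj_onI)
    fix S S' assume S: "S \<in> Pow (regions D)" "S' \<in> Pow (regions D)" and eq: "\<Phi> S = \<Phi> S'"
    have eqs: "col S (0, Left) = col S' (0, Left)" "change (col S) 0 = change (col S') 0"
      "{k. k < n \<and> change (col S) (p k) \<noteq> change (col S) (nx (p k))} =
        {k. k < n \<and> change (col S') (p k) \<noteq> change (col S') (nx (p k))}"
      using eq unfolding \<Phi>_def prod.inject by blast+
    have bits: "(change (col S) (p k) = change (col S) (nx (p k))) =
        (change (col S') (p k) = change (col S') (nx (p k)))" if "k < n" for k
      using eqs(3)[THEN eqset_imp_iff, of k] that by simp argo
    note ch = change_eqI[OF col col eqs(2) bits]
    have "col S (e, i) = col S' (e, i)" if "e \<in> edges D" for e i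
      by (rule colouring_eqI[OF col col eqs(1) ch that])
    then have "{s \<in> edges D \<times> UNIV. col S s} = {s \<in> edges D \<times> UNIV. col S' s}"
      by auto
    then show "S = S'"
      using S(1)[unfolded Pow_iff, THEN recover] S(2)[unfolded Pow_iff, THEN recover] by simp
  qed
  have "card (\<Phi> ` Pow (regions D)) = 2 ^ (n + 2)"
    using knot by (simp add: card_image[OF inj] card_Pow finite_regions knot_diagram_def)
  also have "\<dots> = card ?B"
    by (simp add: card_cartesian_product card_Pow)
  finally have "\<Phi> ` Pow (regions D) = ?B"
    by (intro card_subset_eq) (auto simp: \<Phi>_def)
  \<comment> \<open>The colour changes across the edge \<open>0\<close> and no crossing switches
    this, so it changes across every edge. The value \<open>False\<close> at the starting side is an
    arbitrary choice.\<close>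
  then have "(False, True, {}) \<in> \<Phi> ` Pow (regions D)" by simp
  then obtain S where "\<Phi> S = (False, True, {})" by auto
  then have S: "change (col S) 0"
    "\<And>k. k < n \<Longrightarrow> change (col S) (p k) = change (col S) (nx (p k))"
    by (auto simp: \<Phi>_def)
  have "change (col S) e" if "e \<in> edges D" for e
    by (rule edge_induct[where P = "change (col S)", OF zero_edge S(1) that])
      (use S(2) change_crossing[OF col] in metis)+
  with col that show thesis by blast
qed

section \<open>Parity of the number of crossings with the diagram\<close>

lemma crossing_parity_cross: "((e, i), b) \<in> crossing_parity D \<Longrightarrow> \<exists>b. ((e, j), b) \<in> crossing_parity D"
  by (cases i; cases j) (auto intro: crossing_parity.intros)

lemma crossing_parity_turn: "(s, b) \<in> crossing_parity D \<Longrightarrow> (s, t) \<in> corners D \<union> (corners D)\<inverse> \<Longrightarrow>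
   \<exists>b. (t, b) \<in> crossing_parity D"
  by (auto intro: crossing_parity.turn)

text \<open>A path in the plane can follow the knot from the outer edge. Since an edge may be
  crossed, it does not matter which of its sides has been reached, and \<open>Q\<close> ignores the
  side.\<close>

lemma crossing_parity_total:
  assumes "e \<in> edges D"
  shows "\<exists>b. ((e, Left), b) \<in> crossing_parity D"
proof -
  define Q where "Q e \<longleftrightarrow> (\<exists>i b. ((e, i), b) \<in> crossing_parity D)" for e
  have turn: "Q (fst t)" if "Q (fst s)" "(s, t) \<in> corners D \<union> (corners D)\<inverse>" for s t
    using that crossing_parity_cross crossing_parity_turn unfolding Q_def by (metis prod.collapse)
  have c: "((p k, Right), (nx (q k), Right)) \<in> corners D \<union> (corners D)\<inverse>"
    "((nx (q k), Left), (nx (p k), Right)) \<in> corners D \<union> (corners D)\<inverse>"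
    "((q k, Left), (nx (p k), Left)) \<in> corners D \<union> (corners D)\<inverse>"
    "((nx (p k), Right), (nx (q k), Left)) \<in> corners D \<union> (corners D)\<inverse>" if "k < n" for k
    using that unfolding corners_sym Let_def by blast+
  have "Q e"
  proof (rule edge_induct[where P = Q, OF _ _ assms])
    show "fst (outer D) \<in> edges D"
      using knot by (simp add: knot_diagram_def)
    show "Q (fst (outer D))"
      unfolding Q_def by (metis crossing_parity.start prod.collapse)
    show "Q (nx (p k))" if "k < n" "Q (p k)" for k
      using turn[OF _ c(1)] turn[OF _ c(2)] that by simp
    show "Q (nx (q k))" if "k < n" "Q (q k)" for k
      using turn[OF _ c(3)] turn[OF _ c(4)] that by simp
  qed
  then show ?thesis
    using crossing_parity_cross by (auto simp: Q_def)
qed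

text \<open>A checkerboard colour is constant around corners and flips across each edge, so the
  parity along any path is the colour difference between its ends. In particular it does not depend
  on the path.\<close>

lemma crossing_parity_colouring:
  assumes "colouring \<chi>" "\<And>e. e \<in> edges D \<Longrightarrow> change \<chi> e" "(s, b) \<in> crossing_parity D"
  shows "fst s \<in> edges D \<and> (b \<longleftrightarrow> \<chi> s \<noteq> \<chi> (outer D))"
  using assms(3)
proof induction
  case start
  then show ?case using knot by (simp add: knot_diagram_def)
next
  case (turn s b t)
  then show ?case
    using colouring_corner[OF assms(1) turn(2)] corners_edge[OF turn(2)] by auto
qed (use assms(2) in \<open>auto simp: change_def\<close>)

section \<open>Circles of a resolution\<close>

definition joined :: "nat set \<Rightarrow> (nat \<times> nat) set" where
  "joined v = (\<Union>k<n. let A = (if k \<in> v \<longleftrightarrow> k \<in> neg then {(p k, nx (q k)), (q k, nx (p k))}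
      else {(p k, q k), (nx (p k), nx (q k))}) in A \<union> A\<inverse>)"

definition circle :: "nat set \<Rightarrow> nat \<Rightarrow> nat set" where
  "circle v e = (joined v)\<^sup>* `` {e}"

text \<open>The condition \<open>k \<in> v \<longleftrightarrow> k \<in> neg\<close> says that the
  crossing is smoothed respecting the orientation. Such a smoothing links an incoming edge with the
  outgoing edge of the other strand; the opposite one links the two incoming and the two outgoing
  edges.\<close>

lemma joined_eq:
  "joined v = (\<Union>k<n. smoothing D (crossings D ! k) (k \<in> v)) \<union>
     (\<Union>k<n. smoothing D (crossings D ! k) (k \<in> v))\<inverse>"
  unfolding converse_UNION UN_Un_distrib[symmetric] joined_def
  by (intro SUP_cong refl)
    (auto simp: neg_iff Let_def smoothing_def edge_at_def edge_ends_def p_def q_def numeral_eq_Suc)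

lemma joined_sym: "(e, f) \<in> joined v \<Longrightarrow> (f, e) \<in> joined v"
  by (auto simp: joined_eq)

lemma circles_eq: "circles D v = circle v ` edges D"
  by (simp add: circles_def classes_eq circle_def joined_eq)

lemma circle_eq_iff: "circle v e = circle v f \<longleftrightarrow> (e, f) \<in> (joined v)\<^sup>*"
  unfolding circle_def joined_eq by (rule sym_closure_class_eq_iff)

lemma mem_circle: "f \<in> circle v e \<longleftrightarrow> circle v e = circle v f"
  by (simp add: circle_eq_iff) (simp add: circle_def)

lemma finite_circles [simp]: "finite (circles D v)"
  by (simp add: circles_eq)

lemma circle_in [simp]: "e \<in> edges D \<Longrightarrow> circle v e \<in> circles D v"
  by (simp add: circles_eq)

lemma joined_oriented:
  assumes "k < n"
  shows "(p k, nx (q k)) \<in> joined neg" "(q k, nx (p k)) \<in> joined neg"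
  using assms by (force simp: joined_def)+

lemma circle_next:
  assumes "k < n"
  shows "circle neg (nx (q k)) = circle neg (p k)" "circle neg (nx (p k)) = circle neg (q k)"
  using joined_oriented[OF assms] joined_sym by (auto simp: circle_eq_iff)

text \<open>The checkerboard colour to the left is constant along a Seifert circle. At the crossing,
  the left of \<open>p k\<close> and the right of \<open>q k\<close> are the same region, so the
  colours to the left of the two circles differ; the parity is this colour compared with that of the
  outer region.\<close>

lemma odd_circle_differ:
  assumes "k < n"
  shows "odd_circle D (circle neg (p k)) \<noteq> odd_circle D (circle neg (q k))"
proof -
  obtain \<chi> where \<chi>: "colouring \<chi>" "\<And>e. e \<in> edges D \<Longrightarrow> change \<chi> e"
    using checkerboard_colouring by blast
  have ch: "\<chi> (e, Left) \<noteq> \<chi> (e, Right)" if "e \<in> edges D" for e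
    using \<chi>(2)[OF that] by (simp add: change_def)
  have step: "\<chi> (e, Left) = \<chi> (f, Left)" if "(e, f) \<in> joined neg" for e f
  proof -
    obtain k where k: "k < n" and ef: "(e, f) \<in> {(p k, nx (q k)), (q k, nx (p k)),
        (nx (q k), p k), (nx (p k), q k)}"
      using \<open>(e, f) \<in> joined neg\<close> by (auto simp: joined_def Let_def)
    note * = colouring_crossing[OF \<chi>(1) k] ch[of "p k"] ch[of "nx (q k)"]
    from ef show ?thesis using * k by auto
  qed
  have const: "\<chi> (e, Left) = \<chi> (f, Left)" if "(e, f) \<in> (joined neg)\<^sup>*" for e f
    using that by induction (auto dest: step)
  have odd: "odd_circle D (circle neg e) \<longleftrightarrow> \<chi> (e, Left) \<noteq> \<chi> (outer D)" if "e \<in> edges D" for e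
  proof -
    obtain b where b: "((e, Left), b) \<in> crossing_parity D"
      using crossing_parity_total \<open>e \<in> edges D\<close> by blast
    have "e \<in> circle neg e" by (simp add: mem_circle)
    then show ?thesis
      using b crossing_parity_colouring[OF \<chi>] const[of e] unfolding odd_circle_def circle_def by fastforce
  qed
  show ?thesis
    using colouring_crossing[OF \<chi>(1) assms] ch[of "q k"] assms by (simp add: odd)
qed

lemma circle_differ: "k < n \<Longrightarrow> circle neg (p k) \<noteq> circle neg (q k)"
  using odd_circle_differ by metis

section \<open>Switching one crossing of the oriented resolution\<close>

definition seifert_succ :: "nat \<Rightarrow> nat" where
  "seifert_succ e = nx (THE f. \<exists>k<n. (e, f) = (p k, q k) \<or> (e, f) = (q k, p k))"

lemma seifert_succ [simp]:
  assumes "k < n"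
  shows "seifert_succ (p k) = nx (q k)" "seifert_succ (q k) = nx (p k)"
  unfolding seifert_succ_def
  by (rule arg_cong[where f = nx], rule the_equality, use assms strand_inj in auto)+

text \<open>\<open>seifert_succ\<close> follows a Seifert circle in its direction: at each crossing
  it exchanges the two incoming edges and then applies \<open>nx\<close>, and both maps are
  injective.\<close>

lemma inj_seifert_succ: "inj_on seifert_succ (edges D)"
proof (rule inj_onI)
  fix e f assume ef: "e \<in> edges D" "f \<in> edges D" "seifert_succ e = seifert_succ f"
  show "e = f"
  proof (cases "n = 0")
    case True
    with ef show ?thesis by (simp add: edges_def num_edges_def)
  next
    case False
    then have "n > 0" by simp
    obtain k where k: "k < n" "e = p k \<or> e = q k"
      by (rule edge_cases[OF ef(1) \<open>n > 0\<close>])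
    obtain l where l: "l < n" "f = p l \<or> f = q l"
      by (rule edge_cases[OF ef(2) \<open>n > 0\<close>])
    from ef(3) k l show ?thesis
      by (auto dest!: nx_inj[rotated 2] simp: strand_inj)
  qed
qed

text \<open>
  Removing one arc from a circle of the oriented resolution does not disconnect it: otherwise the
  injection \<open>seifert_succ\<close> would map the finite set of the edges still reachable from \<open>nx y\<close> into
  itself without attaining \<open>nx y\<close>.
\<close>

lemma bypass:
  assumes k: "k < n" and xy: "(x, y) = (p k, q k) \<or> (x, y) = (q k, p k)"
    and J: "\<And>l. l < n \<Longrightarrow> l \<noteq> k \<Longrightarrow> {(p l, nx (q l)), (q l, nx (p l))} \<subseteq> J"
  shows "(nx y, x) \<in> J\<^sup>*"
proof (rule ccontr)
  assume not: "(nx y, x) \<notin> J\<^sup>*"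
  \<comment> \<open>Intersecting with \<open>joined neg\<close> keeps \<open>P\<close> inside the
    Seifert circle of \<open>nx y\<close>. This is the circle of \<open>x\<close>, and it does not
    contain \<open>y\<close>.\<close>
  define P where "P = {e \<in> edges D. (nx y, e) \<in> (J \<inter> joined neg)\<^sup>*}"
  have n: "n > 0" using k by simp
  have x: "x \<notin> P"
    using not rtrancl_mono[of "J \<inter> joined neg" J] by (auto simp: P_def)
  have y: "y \<notin> P"
  proof
    assume "y \<in> P"
    then have "(nx y, y) \<in> (joined neg)\<^sup>*"
      using rtrancl_mono[of "J \<inter> joined neg" "joined neg"] by (auto simp: P_def)
    then have "circle neg (nx y) = circle neg y" by (simp add: circle_eq_iff)
    then show False
      using xy circle_next[OF k] circle_differ[OF k] by auto
  qed
  have "seifert_succ ` P \<subseteq> P"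
  proof (intro image_subsetI)
    fix e assume e: "e \<in> P"
    then have "e \<in> edges D" by (simp add: P_def)
    then obtain l where l: "l < n" "e = p l \<or> e = q l"
      by (rule edge_cases[OF _ n])
    with e x y xy have "l \<noteq> k" by auto
    then have "(e, seifert_succ e) \<in> J \<inter> joined neg"
      using J[OF l(1)] joined_oriented[OF l(1)] l by auto
    moreover have "seifert_succ e \<in> edges D"
      using l by auto
    ultimately show "seifert_succ e \<in> P"
      using e by (auto simp: P_def intro: rtrancl_into_rtrancl)
  qed
  moreover have PE: "P \<subseteq> edges D" by (auto simp: P_def)
  ultimately have "seifert_succ ` P = P"
    using inj_on_subset[OF inj_seifert_succ PE] finite_subset[OF PE finite_edges]
    by (intro endo_inj_surj) auto
  moreover have "nx y \<in> P" by (auto simp: P_def)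
  ultimately obtain e where e: "e \<in> P" "seifert_succ e = nx y"
    by (metis imageE)
  have "seifert_succ x = nx y" "x \<in> edges D"
    using xy k by auto
  then have "e = x"
    using e PE inj_onD[OF inj_seifert_succ, of e x] by auto
  with e x show False by simp
qed

text \<open>By \<open>bypass\<close>, each of \<open>a\<close> and \<open>b\<close> stays connected
  when its arc at the crossing is removed. The two new arcs connect what is left of \<open>a\<close>
  with what is left of \<open>b\<close>, and all other circles are untouched.\<close>

lemma circles_switch:
  assumes k: "k < n" and v: "\<forall>l<n. (l \<in> v \<longleftrightarrow> l \<in> neg) \<longleftrightarrow> l \<noteq> k"
  defines "a \<equiv> circle neg (p k)" and "b \<equiv> circle neg (q k)"
  shows "circles D v = insert (a \<union> b) (oriented_circles D - {a, b})"
proof -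
  have J: "{(p l, nx (q l)), (q l, nx (p l))} \<subseteq> joined v" if "l < n" "l \<noteq> k" for l
    using that v by (force simp: joined_def)
  have J': "(nx (p k), nx (q k)) \<in> joined v" "(p k, q k) \<in> joined v"
    using k v by (force simp: joined_def)+
  have cv: "circle v (nx (q k)) = circle v (p k)" "circle v (nx (p k)) = circle v (q k)"
    "circle v (p k) = circle v (q k)"
    using bypass[OF k _ J] J' by (auto simp: circle_eq_iff)
  \<comment> \<open>Edges on one Seifert circle stay on one circle of \<open>v\<close>: the links
    lost at \<open>k\<close> are replaced by \<open>cv\<close>.\<close>
  have c1: "circle v e = circle v f" if "(e, f) \<in> joined neg" for e f
  proof -
    obtain l where l: "l < n" "(e, f) \<in> {(p l, nx (q l)), (q l, nx (p l)),
        (nx (q l), p l), (nx (p l), q l)}"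
      using \<open>(e, f) \<in> joined neg\<close> by (auto simp: joined_def Let_def)
    show ?thesis
    proof (cases "l = k")
      case True
      with l cv show ?thesis by auto
    next
      case False
      with J[OF l(1)] joined_sym l show ?thesis
        by (auto simp: circle_eq_iff)
    qed
  qed
  have c1': "circle v e = circle v f" if "circle neg e = circle neg f" for e f
    using that unfolding circle_eq_iff[of neg] by induction (auto dest: c1)
  \<comment> \<open>Conversely, every link of \<open>v\<close> stays on a Seifert circle or inside
    \<open>a \<union> b\<close>, so nothing else merges.\<close>
  have c2: "circle neg e = circle neg f \<or> (e \<in> a \<union> b \<and> f \<in> a \<union> b)" if "(e, f) \<in> joined v" for e f
  proof -
    obtain l where l: "l < n" "(e, f) \<in> (let A = if l \<noteq> k then {(p l, nx (q l)), (q l, nx (p l))}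
        else {(p l, q l), (nx (p l), nx (q l))} in A \<union> A\<inverse>)"
      using \<open>(e, f) \<in> joined v\<close> v by (auto simp only: joined_def lessThan_iff)
    show ?thesis
    proof (cases "l = k")
      case True
      with l(2) have "(e, f) \<in> {(p k, q k), (q k, p k), (nx (q k), nx (p k)), (nx (p k), nx (q k))}"
        by (auto simp: Let_def)
      then show ?thesis
        using circle_next[OF k] by (auto simp: a_def b_def mem_circle)
    next
      case False
      with l(2) have "(e, f) \<in> {(p l, nx (q l)), (q l, nx (p l)), (nx (q l), p l), (nx (p l), q l)}"
        by (auto simp: Let_def)
      then show ?thesis
        using circle_next[OF l(1)] by auto
    qed
  qed
  have c2': "circle neg e = circle neg f \<or> (e \<in> a \<union> b \<and> f \<in> a \<union> b)" if "circle v e = circle v f" for e f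
    using that unfolding circle_eq_iff[of v]
  proof induction
    case (step f g)
    then show ?case
      using c2[of f g] unfolding Un_iff a_def b_def mem_circle by argo
  qed simp
  have in_ab: "circle v e = a \<union> b" if "e \<in> a \<union> b" for e
  proof -
    have ab: "circle v f = circle v (p k)" if "f \<in> a \<union> b" for f
      using that c1'[of "p k" f] c1'[of "q k" f] cv(3) by (auto simp: a_def b_def mem_circle)
    have "f \<in> a \<union> b" if "circle v e = circle v f" for f
      using c2'[OF that] \<open>e \<in> a \<union> b\<close> by (auto simp: a_def b_def mem_circle)
    moreover have "circle v e = circle v f" if "f \<in> a \<union> b" for f
      using ab[OF that] ab[OF \<open>e \<in> a \<union> b\<close>] by simp
    ultimately have "f \<in> circle v e \<longleftrightarrow> f \<in> a \<union> b" for f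
      unfolding mem_circle[of f v e] by (rule iffI)
    then show ?thesis by (rule set_eqI)
  qed
  have out_ab: "circle v e = circle neg e" if "e \<notin> a \<union> b" for e
  proof -
    have "f \<in> circle v e \<longleftrightarrow> f \<in> circle neg e" for f
      unfolding mem_circle[of f v e] mem_circle[of f neg e] using that c2'[of e f] c1'[of e f] by argo
    then show ?thesis by (rule set_eqI)
  qed
  show ?thesis
  proof
    show "circles D v \<subseteq> insert (a \<union> b) (oriented_circles D - {a, b})"
    proof
      fix c assume "c \<in> circles D v"
      then obtain e where e: "e \<in> edges D" "c = circle v e" by (auto simp: circles_eq)
      show "c \<in> insert (a \<union> b) (oriented_circles D - {a, b})"
      proof (cases "e \<in> a \<union> b")
        case False
        then have "circle neg e \<noteq> a" "circle neg e \<noteq> b"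
          by (auto simp: a_def b_def mem_circle)
        with False e out_ab show ?thesis by auto
      qed (use e in_ab in auto)
    qed
    have "a \<union> b = circle v (p k)"
      using in_ab[of "p k"] by (simp add: a_def mem_circle)
    then have "a \<union> b \<in> circles D v"
      using k by simp
    moreover have "c \<in> circles D v" if "c \<in> oriented_circles D" "c \<noteq> a" "c \<noteq> b" for c
    proof -
      obtain e where e: "e \<in> edges D" "c = circle neg e"
        using \<open>c \<in> oriented_circles D\<close> by (auto simp: circles_eq)
      then have "e \<notin> a \<union> b"
        using that by (auto simp: a_def b_def mem_circle)
      with e out_ab show ?thesis by (metis circle_in)
    qed
    ultimately show "insert (a \<union> b) (oriented_circles D - {a, b}) \<subseteq> circles D v"
      by blast
  qed
qed

text \<open>The set \<open>a \<union> b\<close> meets two different Seifert circles, so it is not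
  itself one of them. This is the form in which \<open>lee_edge\<close> recognises merges and
  splittings.\<close>

lemma circles_switch_diff:
  assumes k: "k < n" and v: "\<forall>l<n. (l \<in> v \<longleftrightarrow> l \<in> neg) \<longleftrightarrow> l \<noteq> k"
  defines "a \<equiv> circle neg (p k)" and "b \<equiv> circle neg (q k)"
  shows "oriented_circles D - circles D v = {a, b}"
    and "circles D v - oriented_circles D = {a \<union> b}"
    and "oriented_circles D \<inter> circles D v = oriented_circles D - {a, b}"
    and "circles D v \<inter> oriented_circles D = oriented_circles D - {a, b}"
proof -
  have ab: "a \<in> oriented_circles D" "b \<in> oriented_circles D" "a \<noteq> b"
    using k circle_differ[OF k] by (auto simp: a_def b_def)
  have "a \<union> b \<notin> oriented_circles D"
  proof
    assume "a \<union> b \<in> oriented_circles D"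
    then obtain e where e: "a \<union> b = circle neg e" by (auto simp: circles_eq)
    have "p k \<in> a \<union> b" "q k \<in> a \<union> b"
      by (auto simp: a_def b_def mem_circle)
    with e ab show False
      by (auto simp: a_def b_def mem_circle)
  qed
  then show "oriented_circles D - circles D v = {a, b}"
    "circles D v - oriented_circles D = {a \<union> b}"
    "oriented_circles D \<inter> circles D v = oriented_circles D - {a, b}"
    "circles D v \<inter> oriented_circles D = oriented_circles D - {a, b}"
    using ab circles_switch[OF k v] unfolding a_def[symmetric] b_def[symmetric] by auto
qed

end

section \<open>The Lee complex in homological degree zero\<close>

lemma UNIV_lee_basis: "UNIV = {One, X}"
  using lee_basis.exhaust by auto

instance lee_basis :: finite
  by standard (simp add: UNIV_lee_basis)

text \<open>This is multiplication by \<open>x\<close>, which permutes the basis because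
  \<open>x\<close> squares to 1.\<close>

fun other :: "lee_basis \<Rightarrow> lee_basis" where
  "other One = X"
| "other X = One"

lemma other_other [simp]: "other (other x) = x"
  by (cases x) auto

lemma lee_mult_commute: "lee_mult x y = lee_mult y x"
  by (cases x; cases y) auto

lemma lee_comult_commute: "(x, y) \<in> lee_comult z \<longleftrightarrow> (y, x) \<in> lee_comult z"
  by (cases z) auto

text \<open>The comultiplication of \<open>x\<close> times \<open>z\<close> consists of the pairs
  with product \<open>z\<close>. Sums over the sources of a merge thus become sums over a
  comultiplication.\<close>

lemma lee_mult_eq_iff: "z = lee_mult x y \<longleftrightarrow> (x, y) \<in> lee_comult (other z)"
  by (cases x; cases y; cases z) auto

lemma lee_comult_eq: "lee_comult (other (lee_mult x y)) = {(x, y), (other x, other y)}"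
  by (cases x; cases y) auto

text \<open>Only the labels of \<open>a\<close> and \<open>b\<close> vary, so the sum is a product
  of fixed weights times a sum over \<open>lee_comult r\<close>; the two hypotheses are the
  vanishing of that sum for \<open>r = One\<close> and \<open>r = X\<close>. It serves both for the
  canonical cycle and for evaluations of boundaries.\<close>

lemma sum_comult_weights:
  fixes \<omega> :: "'a \<Rightarrow> lee_basis \<Rightarrow> complex"
  assumes C: "finite C" "a \<in> C" "b \<in> C" "a \<noteq> b"
    and 1: "\<omega> a One * \<omega> b X + \<omega> a X * \<omega> b One = 0"
    and 2: "\<omega> a X * \<omega> b X + \<omega> a One * \<omega> b One = 0"
  shows "(\<Sum>f | f \<in> C \<rightarrow>\<^sub>E UNIV \<and> (\<forall>c \<in> C - {a, b}. f c = g c) \<and> (f a, f b) \<in> lee_comult r.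
    \<Prod>c\<in>C. \<omega> c (f c)) = 0"
proof -
  define h where "h = (\<lambda>(x, y). restrict (\<lambda>c. if c = a then x else if c = b then y else g c) C)"
  have "{f. f \<in> C \<rightarrow>\<^sub>E UNIV \<and> (\<forall>c \<in> C - {a, b}. f c = g c) \<and> (f a, f b) \<in> lee_comult r}
      = h ` lee_comult r"
  proof (intro equalityI subsetI)
    fix f assume f: "f \<in> {f. f \<in> C \<rightarrow>\<^sub>E UNIV \<and> (\<forall>c \<in> C - {a, b}. f c = g c) \<and>
      (f a, f b) \<in> lee_comult r}"
    then have "f = h (f a, f b)"
      using C by (intro extensionalityI[of _ C]) (auto simp: h_def PiE_def)
    with f show "f \<in> h ` lee_comult r" by blast
  qed (use C in \<open>auto simp: h_def split: if_splits\<close>)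
  moreover have "inj_on h (lee_comult r)"
    by (rule inj_on_inverseI[where g = "\<lambda>f. (f a, f b)"]) (use C in \<open>auto simp: h_def\<close>)
  moreover have "(\<Prod>c\<in>C. \<omega> c (h xy c)) =
      \<omega> a (fst xy) * \<omega> b (snd xy) * (\<Prod>c\<in>C - {a, b}. \<omega> c (g c))" for xy
  proof -
    have "C = insert a (insert b (C - {a, b}))" using C by auto
    then have "(\<Prod>c\<in>C. \<omega> c (h xy c)) =
        \<omega> a (h xy a) * (\<omega> b (h xy b) * (\<Prod>c\<in>C - {a, b}. \<omega> c (h xy c)))"
      using C by (metis (no_types, lifting) DiffE finite_Diff finite_insert insert_iff prod.insert)
    also have "(\<Prod>c\<in>C - {a, b}. \<omega> c (h xy c)) = (\<Prod>c\<in>C - {a, b}. \<omega> c (g c))"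
      by (intro prod.cong) (auto simp: h_def split: prod.splits)
    finally show ?thesis
      using C by (simp add: h_def case_prod_unfold mult.assoc)
  qed
  ultimately have "(\<Sum>f | f \<in> C \<rightarrow>\<^sub>E UNIV \<and> (\<forall>c \<in> C - {a, b}. f c = g c) \<and>
      (f a, f b) \<in> lee_comult r. \<Prod>c\<in>C. \<omega> c (f c)) =
      (\<Sum>(x, y)\<in>lee_comult r. \<omega> a x * \<omega> b y) * (\<Prod>c\<in>C - {a, b}. \<omega> c (g c))"
    by (simp add: sum.reindex sum_distrib_right case_prod_unfold)
  also have "(\<Sum>(x, y)\<in>lee_comult r. \<omega> a x * \<omega> b y) = 0"
    using 1 2 by (cases r) auto
  finally show ?thesis by simp
qed

lemma lee_edge_merge:
  assumes "A - B = {a, b}" "B - A = {c}" "a \<noteq> b"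
  shows "lee_edge A f B f' \<longleftrightarrow>
    (\<forall>d \<in> A \<inter> B. f d = f' d) \<and> f' c = lee_mult (f a) (f b)"
proof -
  have "(\<forall>d \<in> A \<inter> B. f d = f' d) \<longleftrightarrow> (\<forall>d \<in> A \<inter> B. f' d = f d)"
    by force
  then show ?thesis
    using assms unfolding lee_edge_def by (auto simp: doubleton_eq_iff lee_mult_commute)
qed

lemma lee_edge_split:
  assumes "B - A = {a, b}" "A - B = {c}" "a \<noteq> b"
  shows "lee_edge A f B f' \<longleftrightarrow>
    (\<forall>d \<in> A \<inter> B. f' d = f d) \<and> (f' a, f' b) \<in> lee_comult (f c)"
  using assms unfolding lee_edge_def by (auto simp: doubleton_eq_iff lee_comult_commute)

section \<open>Linearity and homology classes\<close>

lemma lee_differential_add: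
  "lee_differential D (\<lambda>g. z g + w g) = (\<lambda>g. lee_differential D z g + lee_differential D w g)"
  by (auto simp: lee_differential_def fun_eq_iff sum.distrib distrib_left)

lemma lee_differential_diff:
  "lee_differential D (\<lambda>g. z g - w g) = (\<lambda>g. lee_differential D z g - lee_differential D w g)"
  by (auto simp: lee_differential_def fun_eq_iff sum_subtractf right_diff_distrib)

lemma lee_differential_zero: "lee_differential D (\<lambda>_. 0) = (\<lambda>_. 0)"
  by (auto simp: lee_differential_def fun_eq_iff)

lemma lee_chains_add:
  "z \<in> lee_chains D i \<Longrightarrow> w \<in> lee_chains D i \<Longrightarrow> (\<lambda>g. z g + w g) \<in> lee_chains D i"
  unfolding lee_chains_def mem_Collect_eq by (metis add.right_neutral)

lemma lee_chains_diff:
  "z \<in> lee_chains D i \<Longrightarrow> w \<in> lee_chains D i \<Longrightarrow> (\<lambda>g. z g - w g) \<in> lee_chains D i"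
  unfolding lee_chains_def mem_Collect_eq by (metis diff_self)

lemma lee_filtration_add:
  "z \<in> lee_filtration D j i \<Longrightarrow> w \<in> lee_filtration D j i \<Longrightarrow>
    (\<lambda>g. z g + w g) \<in> lee_filtration D j i"
  unfolding lee_filtration_def mem_Collect_eq by (metis add.right_neutral lee_chains_add)

lemma lee_boundaries_zero: "(\<lambda>_. 0) \<in> lee_boundaries D i"
proof -
  have "(\<lambda>_. 0) \<in> lee_chains D (i - 1)"
    by (simp add: lee_chains_def)
  then have "lee_differential D (\<lambda>_. 0) \<in> lee_boundaries D i"
    unfolding lee_boundaries_def by (rule imageI)
  then show ?thesis by (simp only: lee_differential_zero)
qed

lemma lee_boundaries_add:
  "z \<in> lee_boundaries D i \<Longrightarrow> w \<in> lee_boundaries D i \<Longrightarrow> (\<lambda>g. z g + w g) \<in> lee_boundaries D i"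
  unfolding lee_boundaries_def
  by (auto simp flip: lee_differential_add intro!: imageI lee_chains_add)

lemma lee_boundaries_diff:
  "z \<in> lee_boundaries D i \<Longrightarrow> w \<in> lee_boundaries D i \<Longrightarrow> (\<lambda>g. z g - w g) \<in> lee_boundaries D i"
  unfolding lee_boundaries_def
  by (auto simp flip: lee_differential_diff intro!: imageI lee_chains_diff)

lemma homology_class_eq_iff:
  "homology_class D i z = homology_class D i w \<longleftrightarrow> (\<lambda>g. z g - w g) \<in> lee_boundaries D i"
proof
  assume "homology_class D i z = homology_class D i w"
  moreover have "z \<in> homology_class D i z"
    unfolding homology_class_def using lee_boundaries_zero[of D i] by force
  ultimately obtain b where "b \<in> lee_boundaries D i" "z = (\<lambda>g. w g + b g)"
    unfolding homology_class_def by blast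
  then show "(\<lambda>g. z g - w g) \<in> lee_boundaries D i" by simp
next
  assume b: "(\<lambda>g. z g - w g) \<in> lee_boundaries D i"
  have "(\<lambda>g. z g + c g) \<in> homology_class D i w" if "c \<in> lee_boundaries D i" for c
    unfolding homology_class_def using lee_boundaries_add[OF b that]
    by (intro CollectI exI[of _ "\<lambda>g. z g - w g + c g"]) (auto simp: algebra_simps)
  moreover have "(\<lambda>g. w g + c g) \<in> homology_class D i z" if "c \<in> lee_boundaries D i" for c
    unfolding homology_class_def using lee_boundaries_diff[OF that b]
    by (intro CollectI exI[of _ "\<lambda>g. c g - (z g - w g)"]) (auto simp: algebra_simps)
  ultimately show "homology_class D i z = homology_class D i w"
    by (auto simp: homology_class_def[of D i z] homology_class_def[of D i w])
qed

text \<open>A homology class reaches the filtration level \<open>j\<close> iff it has a representing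
  cycle in that level.\<close>

lemma s_min_eqI:
  assumes z: "z \<in> lee_cycles D 0" "z \<in> lee_filtration D m 0"
    "(\<lambda>g. canonical_chain D g - z g) \<in> lee_boundaries D 0"
    and max: "\<And>z j. z \<in> lee_filtration D j 0 \<Longrightarrow>
      (\<lambda>g. canonical_chain D g - z g) \<in> lee_boundaries D 0 \<Longrightarrow> j \<le> m"
  shows "s_min D = m"
  unfolding s_min_def homology_filtration_def
proof (rule Greatest_equality)
  show "homology_class D 0 (canonical_chain D)
      \<in> homology_class D 0 ` (lee_cycles D 0 \<inter> lee_filtration D m 0)"
    using z by (intro image_eqI[of _ _ z]) (auto simp: homology_class_eq_iff)
  show "j \<le> m" if "homology_class D 0 (canonical_chain D)
      \<in> homology_class D 0 ` (lee_cycles D 0 \<inter> lee_filtration D j 0)" for j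
    using that max by (auto simp: homology_class_eq_iff)
qed

lemma finite_labellings [simp]: "finite (circles D v) \<Longrightarrow> finite (labellings D v)"
  unfolding labellings_def by (rule finite_PiE) auto

section \<open>The canonical chain and positive diagrams\<close>

context diagram_of_knot
begin

text \<open>The canonical chain labels the circle \<open>c\<close> by
  \<open>x + \<epsilon> c\<close>, where \<open>\<epsilon> c\<close> is 1 or -1.\<close>

abbreviation \<epsilon> :: "nat set \<Rightarrow> complex" where
  "\<epsilon> c \<equiv> canonical_coeff (odd_circle D c) One"

lemma coeff_sum: "k < n \<Longrightarrow> \<epsilon> (circle neg (p k)) + \<epsilon> (circle neg (q k)) = 0"
  using odd_circle_differ[of k] by auto

lemma coeff_prod: "k < n \<Longrightarrow> \<epsilon> (circle neg (p k)) * \<epsilon> (circle neg (q k)) = -1"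
  using odd_circle_differ[of k] by auto

lemma circles_nonempty: "oriented_circles D \<noteq> {}"
  using circle_in[OF zero_edge] by blast

lemma canonical_chain_in: "canonical_chain D \<in> lee_chains D 0"
  using neg_subset
  by (auto simp: lee_chains_def canonical_chain_def generators_def hom_degree_def split: if_splits)

lemma crossing_signs:
  "positive_diagram D \<Longrightarrow> neg = {} \<and> pos_crossings D = {..<n}"
  "negative_diagram D \<Longrightarrow> neg = {..<n} \<and> pos_crossings D = {}"
  by (auto simp: positive_diagram_def negative_diagram_def neg_crossings_def pos_crossings_def
      num_crossings_def)

text \<open>Every edge leaving the oriented resolution merges two circles with opposite signs, and
  (x + 1)(x - 1) = 0 in the algebra.\<close>

lemma canonical_cycle_positive:
  assumes "neg = {}"
  shows "canonical_chain D \<in> lee_cycles D 0"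
proof -
  have "(\<Sum>g | g \<in> labellings D (v - {k}) \<and> lee_edge (circles D (v - {k})) g (circles D v) f.
      canonical_chain D (v - {k}, g)) = 0" if k: "k \<in> v" "v \<subseteq> {..<n}" for v f k
  proof (cases "v = {k}")
    case False
    then have "v - {k} \<noteq> {}" using that by blast
    then show ?thesis by (simp add: canonical_chain_def assms)
  next
    case True
    have kn: "k < n" using that by auto
    have v: "\<forall>l<n. (l \<in> v \<longleftrightarrow> l \<in> neg) \<longleftrightarrow> l \<noteq> k"
      using True assms by auto
    let ?a = "circle neg (p k)" and ?b = "circle neg (q k)"
    have ab: "?a \<noteq> ?b" by (rule circle_differ[OF kn])
    have "(\<Sum>g | g \<in> oriented_circles D \<rightarrow>\<^sub>E UNIV \<and> (\<forall>c \<in> oriented_circles D - {?a, ?b}. g c = f c) \<and>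
        (g ?a, g ?b) \<in> lee_comult (other (f (?a \<union> ?b))).
        \<Prod>c\<in>oriented_circles D. canonical_coeff (odd_circle D c) (g c)) = 0"
      using kn ab coeff_sum[OF kn] coeff_prod[OF kn]
      by (intro sum_comult_weights) (auto simp: add.commute)
    also have "(\<Sum>g | g \<in> oriented_circles D \<rightarrow>\<^sub>E UNIV \<and> (\<forall>c \<in> oriented_circles D - {?a, ?b}. g c = f c) \<and>
        (g ?a, g ?b) \<in> lee_comult (other (f (?a \<union> ?b))).
        \<Prod>c\<in>oriented_circles D. canonical_coeff (odd_circle D c) (g c)) =
      (\<Sum>g | g \<in> labellings D neg \<and> lee_edge (oriented_circles D) g (circles D v) f.
        canonical_chain D (neg, g))"
      unfolding lee_edge_merge[OF circles_switch_diff(1,2)[OF kn v] ab]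
        circles_switch_diff(3)[OF kn v] lee_mult_eq_iff
      by (intro sum.cong) (auto simp: labellings_def canonical_chain_def)
    finally show ?thesis
      using True assms by simp
  qed
  then have "lee_differential D (canonical_chain D) = (\<lambda>_. 0)"
    by (auto simp: lee_differential_def generators_def fun_eq_iff intro!: sum.neutral)
  then show ?thesis
    by (simp add: lee_cycles_def canonical_chain_in)
qed

lemma sum_lee_degree_X:
  assumes "finite C" "c \<in> C" "f c = X"
  shows "(\<Sum>c\<in>C. lee_degree (f c)) \<le> int (card C) - 2"
proof -
  have "(\<Sum>c\<in>C. lee_degree (f c)) = lee_degree (f c) + (\<Sum>c\<in>C - {c}. lee_degree (f c))"
    using assms by (simp add: sum.remove)
  also have "(\<Sum>c\<in>C - {c}. lee_degree (f c)) \<le> (\<Sum>c\<in>C - {c}. 1)"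
  proof (rule sum_mono)
    show "lee_degree (f d) \<le> 1" for d by (cases "f d") auto
  qed
  also have "\<dots> = int (card C) - 1"
    using assms by (simp add: card_Diff_singleton of_nat_diff Suc_leI card_gt_0_iff)
      (metis Suc_leI card_gt_0_iff empty_iff of_nat_1 of_nat_diff One_nat_def)
  finally show ?thesis using assms by simp
qed

lemma s_min_positive:
  assumes "positive_diagram D"
  shows "s_min D = int n - int (card (oriented_circles D))"
proof -
  have neg: "neg = {}" "pos_crossings D = {..<n}"
    using crossing_signs assms by auto
  have "lee_chains D (- 1) = {\<lambda>_. 0}"
  proof -
    have "hom_degree D g \<noteq> - 1" for g
      using neg by (auto simp: hom_degree_def split: prod.splits)
    then show ?thesis by (auto simp: lee_chains_def)
  qed
  then have B: "lee_boundaries D 0 = {\<lambda>_. 0}"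
    by (simp add: lee_boundaries_def lee_differential_zero)
  have q: "q_degree D ({}, f) = (\<Sum>c\<in>oriented_circles D. lee_degree (f c)) + int n" for f
    by (simp add: q_degree_def neg)
  have coeff: "canonical_coeff b x \<noteq> 0" for b x
    by (cases x) auto
  show ?thesis
  proof (rule s_min_eqI)
    show "canonical_chain D \<in> lee_cycles D 0"
      by (rule canonical_cycle_positive[OF neg(1)])
    show "canonical_chain D \<in> lee_filtration D (int n - int (card (oriented_circles D))) 0"
    proof -
      have "- int (card (oriented_circles D)) \<le> (\<Sum>c\<in>oriented_circles D. lee_degree (f c))" for f
      proof -
        have "(\<Sum>c\<in>oriented_circles D. -1) \<le> (\<Sum>c\<in>oriented_circles D. lee_degree (f c))"
        proof (rule sum_mono)
          show "-1 \<le> lee_degree (f d)" for d by (cases "f d") auto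
        qed
        then show ?thesis by simp
      qed
      then show ?thesis
        using canonical_chain_in q
        by (fastforce simp: lee_filtration_def canonical_chain_def neg(1) split: if_splits)
    qed
    show "(\<lambda>g. canonical_chain D g - canonical_chain D g) \<in> lee_boundaries D 0"
      by (simp add: B)
    fix z j assume z: "z \<in> lee_filtration D j 0"
      "(\<lambda>g. canonical_chain D g - z g) \<in> lee_boundaries D 0"
    then have zc: "z = canonical_chain D"
      by (simp add: B fun_eq_iff)
    \<comment> \<open>The lowest term: every circle contributes degree -1, and its coefficient in
      the canonical chain is nonzero.\<close>
    define f where "f = restrict (\<lambda>_. X) (oriented_circles D)"
    have "canonical_chain D ({}, f) \<noteq> 0"
      using coeff by (simp add: canonical_chain_def neg(1) f_def labellings_def)
    then have "j \<le> q_degree D ({}, f)"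
      using z(1) zc by (auto simp: lee_filtration_def)
    then show "j \<le> int n - int (card (oriented_circles D))"
      by (simp add: q f_def neg(1))
  qed
qed

section \<open>Negative diagrams: reduction modulo boundaries\<close>

definition single :: "(nat set \<Rightarrow> lee_basis) \<Rightarrow> complex \<Rightarrow> chain" where
  "single f \<sigma> = (\<lambda>g. if g = (neg, f) then \<sigma> else 0)"

text \<open>Multiplication by \<open>x\<close> in the tensor factor of the circle
  \<open>c\<close>.\<close>

definition toggle :: "nat set \<Rightarrow> (nat set \<Rightarrow> lee_basis) \<Rightarrow> nat set \<Rightarrow> lee_basis" where
  "toggle c f = f(c := other (f c))"

lemma toggle_toggle [simp]: "toggle c (toggle c f) = f"
  by (simp add: toggle_def)

lemma toggle_commute: "toggle c (toggle d f) = toggle d (toggle c f)"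
  by (auto simp: toggle_def fun_eq_iff)

lemma toggle_labelling [simp]:
  "f \<in> labellings D v \<Longrightarrow> c \<in> circles D v \<Longrightarrow> toggle c f \<in> labellings D v"
  by (auto simp: toggle_def labellings_def PiE_iff extensional_def)

definition homologous :: "chain \<Rightarrow> chain \<Rightarrow> bool" where
  "homologous z w \<longleftrightarrow> (\<lambda>g. z g - w g) \<in> lee_boundaries D 0"

lemma homologous_refl: "homologous z z"
  by (simp add: homologous_def lee_boundaries_zero)

lemma homologous_trans: "homologous x y \<Longrightarrow> homologous y z \<Longrightarrow> homologous x z"
  unfolding homologous_def by (drule (1) lee_boundaries_add) simp

lemma homologous_add:
  "homologous x y \<Longrightarrow> homologous z w \<Longrightarrow> homologous (\<lambda>g. x g + z g) (\<lambda>g. y g + w g)"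
  unfolding homologous_def by (drule (1) lee_boundaries_add) (simp add: algebra_simps)

text \<open>
  In a negative diagram, all edges of the cube that end at the oriented resolution are splittings,
  and the image of a comultiplication identifies \<open>x\<close> on one of the new circles with \<open>-x\<close> on the
  other.
\<close>

lemma homologous_toggle:
  assumes neg: "neg = {..<n}" and k: "k < n" and f: "f \<in> labellings D neg"
  shows "homologous (single f \<sigma>) (single (toggle (circle neg (p k)) (toggle (circle neg (q k)) f)) (- \<sigma>))"
proof -
  let ?a = "circle neg (p k)" and ?b = "circle neg (q k)"
  let ?v = "neg - {k}"
  let ?f = "toggle ?a (toggle ?b f)"
  have ab: "?a \<noteq> ?b" by (rule circle_differ[OF k])
  have v: "\<forall>l<n. (l \<in> ?v \<longleftrightarrow> l \<in> neg) \<longleftrightarrow> l \<noteq> k"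
    using neg by auto
  \<comment> \<open>The sign of the cube edge; it is put into the coefficient of \<open>w\<close> so
    that it cancels in the differential.\<close>
  define s :: complex where "s = (-1) ^ card {l \<in> neg. l < k}"
  have s: "s * s = 1"
    by (simp add: s_def flip: power_mult_distrib)
  \<comment> \<open>The label on the merged circle is chosen so that its comultiplication has
    exactly the two terms \<open>f\<close> and \<open>?f\<close>, by
    \<open>lee_comult_eq\<close>.\<close>
  define h where "h = restrict (f(?a \<union> ?b := other (lee_mult (f ?a) (f ?b)))) (circles D ?v)"
  have hl: "h \<in> labellings D ?v" by (simp add: h_def labellings_def)
  define w :: chain where "w = (\<lambda>g. if g = (?v, h) then s * \<sigma> else 0)"
  have "w \<in> lee_chains D (0 - 1)"
    using hl k by (auto simp: lee_chains_def w_def generators_def hom_degree_def neg of_nat_diff)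
  have edge: "lee_edge (circles D ?v) h (oriented_circles D) g \<longleftrightarrow> g = f \<or> g = ?f"
    if g: "g \<in> labellings D neg" for g
  proof -
    have sw: "circles D ?v = insert (?a \<union> ?b) (oriented_circles D - {?a, ?b})"
      by (rule circles_switch[OF k v])
    have nin: "?a \<union> ?b \<notin> oriented_circles D"
      using circles_switch_diff(2)[OF k v] by blast
    have h: "h (?a \<union> ?b) = other (lee_mult (f ?a) (f ?b))"
      "\<And>c. c \<in> oriented_circles D - {?a, ?b} \<Longrightarrow> h c = f c"
      using nin by (auto simp: h_def sw)
    have "lee_edge (circles D ?v) h (oriented_circles D) g \<longleftrightarrow>
        (\<forall>c \<in> oriented_circles D - {?a, ?b}. g c = f c) \<and>
        ((g ?a, g ?b) = (f ?a, f ?b) \<or> (g ?a, g ?b) = (other (f ?a), other (f ?b)))"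
      unfolding lee_edge_split[OF circles_switch_diff(1,2)[OF k v] ab]
        circles_switch_diff(4)[OF k v] h(1) lee_comult_eq
      using h(2) by auto
    also have "\<dots> \<longleftrightarrow> g = f \<or> g = ?f"
    proof -
      have ext: "g = g' \<longleftrightarrow> (\<forall>c \<in> oriented_circles D - {?a, ?b}. g c = g' c) \<and> g ?a = g' ?a \<and> g ?b = g' ?b"
        if "g' \<in> labellings D neg" for g'
      proof
        assume eq: "(\<forall>c \<in> oriented_circles D - {?a, ?b}. g c = g' c) \<and> g ?a = g' ?a \<and> g ?b = g' ?b"
        show "g = g'"
        proof (rule PiE_ext)
          show "g c = g' c" if "c \<in> oriented_circles D" for c
            using eq that by (cases "c = ?a"; cases "c = ?b") simp_all
        qed (use g that in \<open>simp_all only: labellings_def\<close>)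
      qed simp
      have "?f \<in> labellings D neg"
        using f k by simp
      from ext[OF f] ext[OF this] ab show ?thesis
        by (auto simp: toggle_def)
    qed
    finally show ?thesis .
  qed
  have f'f: "?f \<noteq> f"
  proof
    assume "?f = f"
    then have "?f ?a = f ?a" by simp
    then show False using ab by (cases "f ?a") (auto simp: toggle_def)
  qed
  have "lee_differential D w = (\<lambda>g. single f \<sigma> g - single ?f (- \<sigma>) g)"
  proof (rule ext, clarify)
    fix v g
    show "lee_differential D w (v, g) = single f \<sigma> (v, g) - single ?f (- \<sigma>) (v, g)"
    proof (cases "(v, g) \<in> generators D")
      case False
      have "(neg, f) \<in> generators D" "(neg, ?f) \<in> generators D"
        using f k neg_subset by (auto simp: generators_def)
      with False show ?thesis
        by (auto simp: lee_differential_def single_def)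
    next
      case True
      let ?S = "\<lambda>l. {h \<in> labellings D (v - {l}). lee_edge (circles D (v - {l})) h (circles D v) g}"
      have fin: "finite (?S l)" for l by simp
      have vn: "v \<subseteq> {..<n}" "g \<in> labellings D v" "finite v"
        using True finite_subset[of v "{..<n}"] by (auto simp: generators_def)
      have zero: "(\<Sum>h\<in>?S l. w (v - {l}, h)) = 0" if "l \<in> v" "\<not> (v = neg \<and> l = k)" for l
      proof -
        have "v - {l} \<noteq> neg - {k}"
          using that k vn unfolding neg by blast
        then show ?thesis by (simp add: w_def)
      qed
      have d: "lee_differential D w (v, g) =
          (\<Sum>l\<in>v. (-1) ^ card {m \<in> v. m < l} * (\<Sum>h\<in>?S l. w (v - {l}, h)))"
        using True by (simp add: lee_differential_def)
      show ?thesis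
      proof (cases "v = neg")
        case False
        then have "lee_differential D w (v, g) = 0"
          unfolding d using zero by (intro sum.neutral) auto
        then show ?thesis using False by (simp add: single_def)
      next
        case True
        have "lee_differential D w (v, g) =
            (\<Sum>l\<in>v. if l = k then s * (\<Sum>h\<in>?S k. w (v - {k}, h)) else 0)"
          unfolding d using zero True by (intro sum.cong) (auto simp: s_def)
        also have "\<dots> = s * (\<Sum>h\<in>?S k. w (v - {k}, h))"
          using True k vn by (simp add: neg)
        also have "(\<Sum>h'\<in>?S k. w (v - {k}, h')) = (\<Sum>h'\<in>?S k. if h' = h then s * \<sigma> else 0)"
          using True by (simp add: w_def)
        also have "\<dots> = (if h \<in> ?S k then s * \<sigma> else 0)"
          using fin[of k] by simp
        also have "h \<in> ?S k \<longleftrightarrow> g = f \<or> g = ?f"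
          using True hl edge[of g] vn by simp
        finally show ?thesis
          using True s f'f by (auto simp: single_def simp flip: mult.assoc)
      qed
    qed
  qed
  then show ?thesis
    unfolding homologous_def lee_boundaries_def
    using \<open>w \<in> lee_chains D (0 - 1)\<close> by (metis imageI)
qed

text \<open>Applying \<open>homologous_toggle\<close> at successive crossings along the knot from
  \<open>0\<close> to \<open>e\<close> toggles each intermediate circle twice, which cancels. Only
  the existence of some coefficient is recorded.\<close>

lemma homologous_toggle_base:
  assumes neg: "neg = {..<n}" and e: "e \<in> edges D" and f: "f \<in> labellings D neg"
  shows "\<exists>\<tau>. homologous (single f \<sigma>) (single (toggle (circle neg 0) (toggle (circle neg e) f)) \<tau>)"
proof -
  define T where "T e \<longleftrightarrow> (\<forall>f \<sigma>. f \<in> labellings D neg \<longrightarrow> (\<exists>\<tau>. homologous (single f \<sigma>)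
      (single (toggle (circle neg 0) (toggle (circle neg e) f)) \<tau>)))" for e
  have step: "T e'" if "T e" "e \<in> edges D" "e' \<in> edges D"
    "\<And>f \<sigma>. f \<in> labellings D neg \<Longrightarrow>
      homologous (single f \<sigma>) (single (toggle (circle neg e) (toggle (circle neg e') f)) (- \<sigma>))" for e e'
    unfolding T_def
  proof (intro allI impI)
    fix f \<sigma> assume f: "f \<in> labellings D neg"
    let ?f = "toggle (circle neg e) (toggle (circle neg e') f)"
    have "?f \<in> labellings D neg" using f that by simp
    then obtain \<tau> where "homologous (single ?f (- \<sigma>))
        (single (toggle (circle neg 0) (toggle (circle neg e) ?f)) \<tau>)"
      using \<open>T e\<close> unfolding T_def by blast
    with homologous_trans[OF that(4)[OF f]]
    show "\<exists>\<tau>. homologous (single f \<sigma>) (single (toggle (circle neg 0) (toggle (circle neg e') f)) \<tau>)"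
      by auto
  qed
  have "T e"
  proof (rule edge_induct[where P = T, OF zero_edge _ e])
    show "T 0" using homologous_refl by (auto simp: T_def)
    fix k assume k: "k < n"
    show "T (nx (p k))" if "T (p k)"
      using step[OF that, of "nx (p k)"] homologous_toggle[OF neg k] k by (simp add: circle_next)
    show "T (nx (q k))" if "T (q k)"
      using step[OF that, of "nx (q k)"] homologous_toggle[OF neg k] k
      by (simp add: circle_next toggle_commute)
  qed
  with f show ?thesis by (simp add: T_def)
qed

text \<open>Each \<open>X\<close> away from the circle of the edge \<open>0\<close> is moved onto
  that circle, which lowers the number of such labels.\<close>

lemma homologous_reduced:
  assumes neg: "neg = {..<n}" and f: "f \<in> labellings D neg"
  shows "\<exists>g \<tau>. g \<in> labellings D neg \<and> (\<forall>c \<in> oriented_circles D - {circle neg 0}. g c = One) \<and>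
    homologous (single f \<sigma>) (single g \<tau>)"
  using f
proof (induction "card {c \<in> oriented_circles D - {circle neg 0}. f c = X}" arbitrary: f \<sigma>
    rule: less_induct)
  case less
  show ?case
  proof (cases "\<exists>c \<in> oriented_circles D - {circle neg 0}. f c = X")
    case False
    then have "\<forall>c \<in> oriented_circles D - {circle neg 0}. f c = One"
      by (metis lee_basis.exhaust)
    with less.prems homologous_refl show ?thesis by blast
  next
    case True
    then obtain e where e: "e \<in> edges D" "circle neg e \<noteq> circle neg 0" "f (circle neg e) = X"
      by (auto simp: circles_eq)
    let ?f = "toggle (circle neg 0) (toggle (circle neg e) f)"
    have f: "?f \<in> labellings D neg"
      using less.prems e by simp
    have val: "?f c = (if c = circle neg e then One else f c)" if "c \<noteq> circle neg 0" for c
      using that e(2,3) by (simp add: toggle_def)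
    have "{c \<in> oriented_circles D - {circle neg 0}. ?f c = X} \<subseteq>
        {c \<in> oriented_circles D - {circle neg 0}. f c = X} - {circle neg e}"
    proof
      fix c assume c: "c \<in> {c \<in> oriented_circles D - {circle neg 0}. ?f c = X}"
      then have "c \<noteq> circle neg 0" by blast
      with c val[of c] show "c \<in> {c \<in> oriented_circles D - {circle neg 0}. f c = X} - {circle neg e}"
        by (cases "c = circle neg e") simp_all
    qed
    moreover have "circle neg e \<in> {c \<in> oriented_circles D - {circle neg 0}. f c = X}"
      using e by simp
    ultimately have "{c \<in> oriented_circles D - {circle neg 0}. ?f c = X} \<subset>
        {c \<in> oriented_circles D - {circle neg 0}. f c = X}"
      by blast
    then have lt: "card {c \<in> oriented_circles D - {circle neg 0}. ?f c = X} <
        card {c \<in> oriented_circles D - {circle neg 0}. f c = X}"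
      by (intro psubset_card_mono) auto
    obtain \<tau> where "homologous (single f \<sigma>) (single ?f \<tau>)"
      using homologous_toggle_base[OF neg e(1) less.prems] by blast
    moreover obtain g \<tau>' where "g \<in> labellings D neg"
      "\<forall>c \<in> oriented_circles D - {circle neg 0}. g c = One"
      "homologous (single ?f \<tau>) (single g \<tau>')"
      using less.hyps[OF lt f, of \<tau>] by (elim exE conjE)
    ultimately show ?thesis
      by (intro exI conjI) (assumption, assumption, rule homologous_trans)
  qed
qed

text \<open>A reduced labelling has label degrees summing to at least the number of circles minus 2,
  and the shift at the oriented resolution is \<open>- n\<close>. Linearity then handles all chains,
  one labelling at a time.\<close>

lemma homologous_filtered:
  assumes neg: "neg = {..<n}" and z: "z \<in> lee_chains D 0"
  shows "\<exists>w \<in> lee_filtration D (int (card (oriented_circles D)) - int n - 2) 0. homologous z w"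
    (is "\<exists>w \<in> ?F. _")
proof -
  have pos: "pos_crossings D = {}"
    using neg by (auto simp: neg_crossings_def pos_crossings_def)
  have one: "\<exists>w \<in> ?F. homologous (single f \<sigma>) w" if "f \<in> labellings D neg" for f \<sigma>
  proof -
    obtain g \<tau> where g: "g \<in> labellings D neg"
      "\<forall>c \<in> oriented_circles D - {circle neg 0}. g c = One"
      "homologous (single f \<sigma>) (single g \<tau>)"
      using homologous_reduced[OF neg \<open>f \<in> labellings D neg\<close>] by blast
    have c0: "circle neg 0 \<in> oriented_circles D" by simp
    then have "card (oriented_circles D) > 0"
      using circles_nonempty by (simp add: card_gt_0_iff)
    moreover have "(\<Sum>c\<in>oriented_circles D. lee_degree (g c)) =
        lee_degree (g (circle neg 0)) + int (card (oriented_circles D) - 1)"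
      using g(2) c0 by (simp add: sum.remove[OF _ c0])
    moreover have "lee_degree (g (circle neg 0)) \<ge> -1"
      by (cases "g (circle neg 0)") auto
    ultimately have "q_degree D (neg, g) \<ge> int (card (oriented_circles D)) - int n - 2"
      by (simp add: q_degree_def pos) (simp add: neg)
    then have "single g \<tau> \<in> ?F"
      using g(1) neg_subset
      by (auto simp: lee_filtration_def lee_chains_def single_def generators_def hom_degree_def)
    with g(3) show ?thesis by blast
  qed
  have part: "\<exists>w \<in> ?F. homologous (\<lambda>g. if fst g = neg \<and> snd g \<in> A then z g else 0) w"
    if "A \<subseteq> labellings D neg" for A
    using finite_subset[OF that finite_labellings[OF finite_circles]] that
  proof (induction A rule: finite_induct)
    case empty
    have "(\<lambda>_. 0) \<in> ?F" by (simp add: lee_filtration_def lee_chains_def)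
    then show ?case using homologous_refl by auto
  next
    case (insert f A)
    obtain w where w: "w \<in> ?F" "homologous (\<lambda>g. if fst g = neg \<and> snd g \<in> A then z g else 0) w"
      using insert by auto
    obtain u where u: "u \<in> ?F" "homologous (single f (z (neg, f))) u"
      using one insert.prems by blast
    have eq: "(\<lambda>g. single f (z (neg, f)) g + (if fst g = neg \<and> snd g \<in> A then z g else 0)) =
        (\<lambda>g. if fst g = neg \<and> snd g \<in> insert f A then z g else 0)"
    proof
      fix g
      show "single f (z (neg, f)) g + (if fst g = neg \<and> snd g \<in> A then z g else 0) =
          (if fst g = neg \<and> snd g \<in> insert f A then z g else 0)"
      proof (cases "g = (neg, f)")
        case True
        then show ?thesis using insert.hyps(2) by (simp add: single_def)
      next
        case False
        then have "\<not> (fst g = neg \<and> snd g = f)" by (simp add: prod_eq_iff)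
        with False show ?thesis by (simp add: single_def) blast
      qed
    qed
    show ?case
      using homologous_add[OF u(2) w(2)] unfolding eq
      by (rule bexI[OF _ lee_filtration_add[OF u(1) w(1)]])
  qed
  \<comment> \<open>In degree 0 all \<open>n\<close> crossings are 1-smoothed, so the chain lives at
    the final vertex alone.\<close>
  have "(if fst g = neg \<and> snd g \<in> labellings D neg then z g else 0) = z g" for g
  proof (cases "z g = 0")
    case False
    then have "g \<in> generators D" "hom_degree D g = 0"
      using z unfolding lee_chains_def by blast+
    then have g: "fst g \<subseteq> neg" "card (fst g) = card neg" "snd g \<in> labellings D (fst g)"
      by (auto simp: generators_def hom_degree_def neg)
    then have "fst g = neg"
      by (intro card_subset_eq) (simp_all add: neg)
    with g show ?thesis by simp
  qed simp
  then show ?thesis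
    using part[OF subset_refl] by simp
qed

section \<open>Negative diagrams: evaluations\<close>

definition weight :: "complex \<Rightarrow> nat set \<Rightarrow> lee_basis \<Rightarrow> complex" where
  "weight t c x = (case x of One \<Rightarrow> 1 | X \<Rightarrow> t * \<epsilon> c)"

text \<open>When \<open>t * t = 1\<close>, this is the algebra homomorphism sending the variable of
  \<open>c\<close> to \<open>t * \<epsilon> c\<close>, applied to the part of the chain at the
  oriented resolution. It respects the relation that the variable squares to 1.\<close>

definition evaluation :: "complex \<Rightarrow> chain \<Rightarrow> complex" where
  "evaluation t z = (\<Sum>f\<in>labellings D neg. z (neg, f) * (\<Prod>c\<in>oriented_circles D. weight t c (f c)))"

text \<open>A splitting into \<open>a\<close> and \<open>b\<close> produces multiples of the sum of
  their variables or of their product plus 1. These evaluate to 0, since the signs of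
  \<open>a\<close> and \<open>b\<close> are opposite.\<close>

lemma evaluation_boundary:
  assumes neg: "neg = {..<n}" and t: "t * t = 1" and b: "b \<in> lee_boundaries D 0"
  shows "evaluation t b = 0"
proof -
  obtain w where w: "b = lee_differential D w"
    using b by (auto simp: lee_boundaries_def)
  let ?P = "\<lambda>f. \<Prod>c\<in>oriented_circles D. weight t c (f c)"
  let ?E = "\<lambda>k g f. lee_edge (circles D (neg - {k})) g (oriented_circles D) f"
  let ?s = "\<lambda>k. (-1) ^ card {l \<in> neg. l < k} :: complex"
  have "b (neg, f) = (\<Sum>k\<in>neg. ?s k * (\<Sum>g | g \<in> labellings D (neg - {k}) \<and> ?E k g f. w (neg - {k}, g)))"
    if "f \<in> labellings D neg" for f
    using that neg_subset by (simp add: w lee_differential_def generators_def)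
  then have "evaluation t b = (\<Sum>f\<in>labellings D neg. \<Sum>k\<in>neg.
      ?s k * (\<Sum>g | g \<in> labellings D (neg - {k}) \<and> ?E k g f. w (neg - {k}, g) * ?P f))"
    unfolding evaluation_def
    by (intro sum.cong refl) (simp add: sum_distrib_right mult.assoc)
  also have "\<dots> = (\<Sum>k\<in>neg. ?s k * (\<Sum>f\<in>labellings D neg.
      \<Sum>g | g \<in> labellings D (neg - {k}) \<and> ?E k g f. w (neg - {k}, g) * ?P f))"
    by (subst sum.swap) (simp add: sum_distrib_left)
  \<comment> \<open>After exchanging the sums, the inner sum evaluates the splitting of a single
    labelling \<open>g\<close>.\<close>
  also have "\<dots> = (\<Sum>k\<in>neg. ?s k * (\<Sum>g\<in>labellings D (neg - {k}). w (neg - {k}, g) *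
      (\<Sum>f | f \<in> labellings D neg \<and> ?E k g f. ?P f)))"
    by (subst sum.swap_restrict) (simp_all add: sum_distrib_left)
  also have "\<dots> = 0"
  proof (intro sum.neutral ballI)
    fix k assume "k \<in> neg"
    then have k: "k < n" by (simp add: neg)
    have v: "\<forall>l<n. (l \<in> neg - {k} \<longleftrightarrow> l \<in> neg) \<longleftrightarrow> l \<noteq> k"
      using neg by auto
    let ?a = "circle neg (p k)" and ?b = "circle neg (q k)"
    have ab: "?a \<noteq> ?b" by (rule circle_differ[OF k])
    have "weight t ?a One * weight t ?b X + weight t ?a X * weight t ?b One =
        t * (\<epsilon> ?a + \<epsilon> ?b)"
      by (simp add: weight_def algebra_simps)
    moreover have "weight t ?a X * weight t ?b X + weight t ?a One * weight t ?b One =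
        (t * t) * (\<epsilon> ?a * \<epsilon> ?b) + 1"
      by (simp add: weight_def algebra_simps)
    ultimately have "(\<Sum>f | f \<in> oriented_circles D \<rightarrow>\<^sub>E UNIV \<and>
        (\<forall>c \<in> oriented_circles D - {?a, ?b}. f c = g c) \<and>
        (f ?a, f ?b) \<in> lee_comult (g (?a \<union> ?b)). ?P f) = 0" for g
      using ab coeff_sum[OF k] coeff_prod[OF k] t k
      by (intro sum_comult_weights) (simp_all del: canonical_coeff.simps)
    then have "(\<Sum>f | f \<in> labellings D neg \<and> ?E k g f. ?P f) = 0" for g
      unfolding lee_edge_split[OF circles_switch_diff(1,2)[OF k v] ab]
        circles_switch_diff(4)[OF k v] labellings_def .
    then show "?s k * (\<Sum>g\<in>labellings D (neg - {k}). w (neg - {k}, g) *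
        (\<Sum>f | f \<in> labellings D neg \<and> ?E k g f. ?P f)) = 0"
      by simp
  qed
  finally show ?thesis .
qed

text \<open>The sum over labellings factors over the circles, and \<open>x + \<epsilon> c\<close> is
  sent to \<open>(1 + t) * \<epsilon> c\<close>.\<close>

lemma evaluation_canonical:
  "evaluation t (canonical_chain D) = (\<Prod>c\<in>oriented_circles D. (1 + t) * \<epsilon> c)"
proof -
  have "evaluation t (canonical_chain D) = (\<Sum>f\<in>oriented_circles D \<rightarrow>\<^sub>E UNIV.
      \<Prod>c\<in>oriented_circles D. canonical_coeff (odd_circle D c) (f c) * weight t c (f c))"
    unfolding evaluation_def labellings_def
    by (intro sum.cong) (simp_all add: canonical_chain_def labellings_def prod.distrib)
  also have "\<dots> = (\<Prod>c\<in>oriented_circles D. \<Sum>x\<in>UNIV. canonical_coeff (odd_circle D c) x * weight t c x)"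
    by (subst prod_sum_PiE) auto
  also have "\<dots> = (\<Prod>c\<in>oriented_circles D. (1 + t) * \<epsilon> c)"
    by (intro prod.cong refl) (simp add: UNIV_lee_basis weight_def algebra_simps)
  finally show ?thesis .
qed

lemma s_min_negative:
  assumes "negative_diagram D"
  shows "s_min D = int (card (oriented_circles D)) - int n - 2"
proof -
  have neg: "neg = {..<n}" and pos: "pos_crossings D = {}"
    using crossing_signs assms by auto
  obtain z where z: "z \<in> lee_filtration D (int (card (oriented_circles D)) - int n - 2) 0"
    "homologous (canonical_chain D) z"
    using homologous_filtered[OF neg canonical_chain_in] by blast
  \<comment> \<open>No edge of the cube leaves the final vertex.\<close>
  have cycle: "lee_chains D 0 \<subseteq> lee_cycles D 0"
  proof
    fix z assume z: "z \<in> lee_chains D 0"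
    have "z (v - {k}, g) = 0" if "k \<in> v" "v \<subseteq> {..<n}" for v k g
    proof -
      have "v - {k} \<subset> {..<n}" using that by blast
      then have "card (v - {k}) < n"
        using psubset_card_mono[of "{..<n}"] by simp
      then have "hom_degree D (v - {k}, g) \<noteq> 0"
        by (simp add: hom_degree_def neg)
      then show ?thesis using z by (auto simp: lee_chains_def)
    qed
    then have "lee_differential D z = (\<lambda>_. 0)"
      by (auto simp: lee_differential_def generators_def fun_eq_iff intro!: sum.neutral)
    with z show "z \<in> lee_cycles D 0" by (simp add: lee_cycles_def)
  qed
  show ?thesis
  proof (rule s_min_eqI)
    show "z \<in> lee_filtration D (int (card (oriented_circles D)) - int n - 2) 0"
      by fact
    then show "z \<in> lee_cycles D 0"
      using cycle by (auto simp: lee_filtration_def)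
    show "(\<lambda>g. canonical_chain D g - z g) \<in> lee_boundaries D 0"
      using z(2) by (simp add: homologous_def)
  next
    fix z j assume z: "z \<in> lee_filtration D j 0"
      "(\<lambda>g. canonical_chain D g - z g) \<in> lee_boundaries D 0"
    show "j \<le> int (card (oriented_circles D)) - int n - 2"
    proof (rule ccontr)
      assume j: "\<not> j \<le> int (card (oriented_circles D)) - int n - 2"
      have ev: "evaluation t z = (\<Prod>c\<in>oriented_circles D. (1 + t) * \<epsilon> c)" if "t * t = 1" for t
      proof -
        have "evaluation t (\<lambda>g. canonical_chain D g - z g) =
            evaluation t (canonical_chain D) - evaluation t z"
          by (simp add: evaluation_def left_diff_distrib sum_subtractf)
        with evaluation_boundary[OF neg that z(2)] evaluation_canonical show ?thesis by simp
      qed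
      \<comment> \<open>Above the claimed level no circle can be labelled \<open>X\<close>, so only
        the constant term remains, whose weight is 1 for every \<open>t\<close>.\<close>
      have const: "evaluation t z = (\<Sum>f\<in>labellings D neg. z (neg, f))" for t
        unfolding evaluation_def
      proof (intro sum.cong refl)
        fix f assume f: "f \<in> labellings D neg"
        show "z (neg, f) * (\<Prod>c\<in>oriented_circles D. weight t c (f c)) = z (neg, f)"
        proof (cases "z (neg, f) = 0")
          case False
          then have "j \<le> q_degree D (neg, f)"
            using z(1) by (auto simp: lee_filtration_def)
          then have "\<not> (\<Sum>c\<in>oriented_circles D. lee_degree (f c)) \<le> int (card (oriented_circles D)) - 2"
            using j by (simp add: q_degree_def pos) (simp add: neg)
          then have "f c = One" if "c \<in> oriented_circles D" for c
            using sum_lee_degree_X[OF finite_circles that, of f] by (cases "f c") auto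
          then show ?thesis by (simp add: weight_def)
        qed simp
      qed
      \<comment> \<open>The evaluations at \<open>t = 1\<close> and \<open>t = -1\<close> would
        agree, but the former is nonzero on the canonical class and the latter is zero.\<close>
      have "(\<Prod>c\<in>oriented_circles D. (1 + 1) * \<epsilon> c) = (\<Prod>c\<in>oriented_circles D. (1 + - 1) * \<epsilon> c)"
        using ev[of 1] ev[of "-1"] const[of 1] const[of "-1"] by simp
      also have "\<dots> = 0"
        using circles_nonempty by (simp add: card_gt_0_iff)
      finally show False by (simp add: prod_zero_iff split: if_splits)
    qed
  qed
qed

section \<open>Components of the Seifert graph\<close>

lemma seifert_graph_endpoints:
  assumes "k < n"
  shows "endpoints (seifert_graph D) k = {circle neg (p k), circle neg (q k)}"
proof -
  have 1: "under (crossings D ! k) \<in> c \<or> over (crossings D ! k) \<in> c \<longleftrightarrow> p k \<in> c \<or> q k \<in> c" for c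
    by (auto simp: p_def q_def)
  have 2: "x \<in> c \<longleftrightarrow> c = circle neg x" if "c \<in> oriented_circles D" for x c
  proof -
    obtain e where "c = circle neg e"
      using \<open>c \<in> oriented_circles D\<close> unfolding circles_eq by blast
    then show ?thesis by (simp only: mem_circle)
  qed
  have "endpoints (seifert_graph D) k =
      {c \<in> oriented_circles D. c = circle neg (p k) \<or> c = circle neg (q k)}"
    unfolding seifert_graph_def signed_graph.simps 1
    by (intro Collect_cong conj_cong refl) (simp only: 2)
  also have "\<dots> = {circle neg (p k), circle neg (q k)}"
    using circle_in[of "p k" neg] circle_in[of "q k" neg] strand_edge[OF assms] by blast
  finally show ?thesis .
qed

lemma components_positive:
  assumes "positive_diagram D"
  shows "card (components (minus_subgraph (seifert_graph D))) = card (oriented_circles D)"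
proof -
  have "adjacency (minus_subgraph (seifert_graph D)) = {}"
    using assms by (auto simp: adjacency_def minus_subgraph_def seifert_graph_def
        positive_diagram_def num_crossings_def)
  then have "components (minus_subgraph (seifert_graph D)) = (\<lambda>c. {c}) ` oriented_circles D"
    by (simp add: components_def classes_eq minus_subgraph_def seifert_graph_def)
  then show ?thesis by (simp add: card_image)
qed

text \<open>All edges of the graph are kept. Each passage of the knot through a crossing goes from
  one Seifert circle to the adjacent one, so the walk along the knot connects all nodes.\<close>

lemma components_negative:
  assumes "negative_diagram D"
  shows "card (components (minus_subgraph (seifert_graph D))) = 1"
proof -
  define R where "R = adjacency (minus_subgraph (seifert_graph D))"
  have adj: "(circle neg (p k), circle neg (q k)) \<in> R" if "k < n" for k
  proof -
    have "k \<in> graph_edges (minus_subgraph (seifert_graph D))"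
      using that assms by (simp add: minus_subgraph_def seifert_graph_def negative_diagram_def
        num_crossings_def)
    moreover have "endpoints (minus_subgraph (seifert_graph D)) k = {circle neg (p k), circle neg (q k)}"
      using seifert_graph_endpoints[OF that] by (simp add: minus_subgraph_def)
    ultimately show ?thesis by (auto simp: R_def adjacency_def)
  qed
  have "(circle neg 0, circle neg e) \<in> (R \<union> R\<inverse>)\<^sup>*" if "e \<in> edges D" for e
    by (rule edge_induct[where P = "\<lambda>e. (circle neg 0, circle neg e) \<in> (R \<union> R\<inverse>)\<^sup>*", OF zero_edge _ that])
      (use adj in \<open>auto simp: circle_next intro: rtrancl_into_rtrancl\<close>)
  then have const: "(R \<union> R\<inverse>)\<^sup>* `` {circle neg e} = (R \<union> R\<inverse>)\<^sup>* `` {circle neg 0}" if "e \<in> edges D" for e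
    unfolding sym_closure_class_eq_iff[symmetric] using that by simp
  have "components (minus_subgraph (seifert_graph D)) =
      (\<lambda>e. (R \<union> R\<inverse>)\<^sup>* `` {circle neg e}) ` edges D"
    unfolding components_def classes_eq R_def[symmetric]
    by (simp add: minus_subgraph_def seifert_graph_def circles_eq image_image)
  also have "\<dots> = (\<lambda>_. (R \<union> R\<inverse>)\<^sup>* `` {circle neg 0}) ` edges D"
    by (rule image_cong[OF refl const])
  also have "\<dots> = {(R \<union> R\<inverse>)\<^sup>* `` {circle neg 0}}"
    by (rule image_constant[OF zero_edge])
  finally show ?thesis by simp
qed

end

theorem proposition1p3:
  fixes D :: diagram
  assumes "knot_diagram D"
    and "positive_diagram D \<or> negative_diagram D"
  shows "rasmussen_s D = U_bound D"
proof -
  interpret diagram_of_knot D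
    by standard fact
  have nodes: "nodes (seifert_graph D) = oriented_circles D"
    by (simp add: seifert_graph_def)
  from assms(2) show ?thesis
  proof
    \<comment> \<open>With N Seifert circles, both sides equal n - N + 1, as every node is its own
      component.\<close>
    assume D: "positive_diagram D"
    then show ?thesis
      using crossing_signs(1)[OF D] s_min_positive[OF D] components_positive[OF D]
      by (simp add: rasmussen_s_def U_bound_def nodes writhe_def)
  next
    \<comment> \<open>With N Seifert circles, both sides equal N - n - 1, as there is a single
      component.\<close>
    assume D: "negative_diagram D"
    then show ?thesis
      using crossing_signs(2)[OF D] s_min_negative[OF D] components_negative[OF D]
      by (simp add: rasmussen_s_def U_bound_def nodes writhe_def)
  qed
qed

end
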